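(* The threshold $(\mathbf{CS,MT})$-reachability problem (chance-interpreted scheduler, mass-interpreted transitions) is undecidable, even when the target set is restricted to finitely generated monotone sets. That is, the following problem is undecidable: given an MDP $\mathcal{M}=(Q,\mathsf{Act},\delta)$, an initial configuration $d_0\in\mathcal{D}(Q)$, a finitely generated monotone target set $H$ and a threshold $\xi\in[0,1]$, decide whether there exists a scheduler $\sigma:\mathcal{D}(Q)^{+}\to\mathcal{D}(\mathsf{Act})$ such that $\mathbb{P}_\sigma\bigl(\mathsf{Reach}_\sigma(d_0,H)\bigr)\ge\xi$ under the $(\mathbf{CS,MT})$ semantics.
   Context: For a set $X$, $\mathcal{D}(X)$ is the set of finitely supported probability distributions on $X$; $A^{+}$ is the set of nonempty finite sequences over $A$. An MDP is $\mathcal{M}=(Q,\mathsf{Act},\delta)$ with $Q,\mathsf{Act}$ finite and $\delta:Q\times\mathsf{Act}\to\mathcal{D}(Q)$; for $a\in\mathsf{Act}$, $M_a$ is the stochastic matrix $(M_a)_{q,q'}=\delta(q,a)(q')$. A configuration is an element of $\mathcal{D}(Q)$, viewed also as a column vector, so that $M_a^Td$ is the configuration $q'\mapsto\sum_q d(q)\delta(q,a)(q')$. A scheduler is a function $\sigma:\mathcal{D}(Q)^{+}\to\mathcal{D}(\mathsf{Act})$ (it may depend on the whole history of configurations). $(\mathbf{CS,MT})$ semantics: $\mathcal{M}$ and $\sigma$ induce a Markov chain on $\mathcal{D}(Q)^{+}$ which moves from $p=d_0d_1\cdots d_k$ to $d_0d_1\cdots d_kd_{k+1}$ with probability $\sum_{a\in\mathsf{Act}:\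 d_{k+1}=M_a^Td_k}\sigma(p)(a)$. $\mathbb{P}_\sigma$ is the induced probability measure on infinite sequences $d_0d_1d_2\cdots$ of configurations started at $d_0$, and $\mathsf{Reach}_\sigma(d_0,H)$ is the set of such sequences with $d_i\in H$ for some $i\ge0$. Monotone sets: order $[0,1]^Q$ componentwise by $\preceq$. A subset of $[0,1]^Q$ is upward-closed (downward-closed) if it contains every element above (below) one of its elements, and monotone if it is upward-closed or downward-closed. An upward-closed set is finitely generated if it equals $\{y\in[0,1]^Q\mid \exists x\in T,\ x\preceq y\}$ for some finite $T\subseteq[0,1]^Q$; dually for downward-closed sets. Such a set is given by its finite generating set $T$; a configuration is in the target if, as a vector in $[0,1]^Q$, it belongs to the set. All numbers in instances are rational. *)

theory Defs
  imports "HOL-Probability.Probability" "HOL-Library.Nat_Bijection"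
begin

section \<open>Partial recursive functions and decidable problems\<close>

datatype recf =
    Zero
  | Succ
  | Proj nat
  | Comp recf "recf list"
  | PrimRec recf recf
  | Mu recf

text \<open>
  \<open>rec_eval f xs y\<close>: the partial recursive function denoted by \<open>f\<close> is defined at the argument
  tuple \<open>xs\<close> and has the value \<open>y\<close>. Terms carry no arities; \<open>f\<close> denotes one partial
  function for every tuple length. In \<open>PrimRec\<close> and \<open>Mu\<close> the recursion or search variable
  comes first.
\<close>

inductive rec_eval :: "recf \<Rightarrow> nat list \<Rightarrow> nat \<Rightarrow> bool" where
  Zero: "rec_eval Zero xs 0"
| Succ: "rec_eval Succ [x] (Suc x)"
| Proj: "i < length xs \<Longrightarrow> rec_eval (Proj i) xs (xs ! i)"
| Comp: "list_all2 (\<lambda>g y. rec_eval g xs y) gs ys \<Longrightarrow> rec_eval f ys y \<Longrightarrow>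
    rec_eval (Comp f gs) xs y"
| PrimRec_0: "rec_eval f xs y \<Longrightarrow> rec_eval (PrimRec f g) (0 # xs) y"
| PrimRec_Suc: "rec_eval (PrimRec f g) (n # xs) r \<Longrightarrow> rec_eval g (n # r # xs) y \<Longrightarrow>
    rec_eval (PrimRec f g) (Suc n # xs) y"
| Mu: "rec_eval f (n # xs) 0 \<Longrightarrow> (\<forall>i<n. \<exists>m>0. rec_eval f (i # xs) m) \<Longrightarrow>
    rec_eval (Mu f) xs n"

lemma rec_eval_deterministic:
  "rec_eval f xs y \<Longrightarrow> rec_eval f xs z \<Longrightarrow> z = y"
proof (induction f xs y arbitrary: z rule: rec_eval.induct)
  case (PrimRec_0 f xs y g)
  from PrimRec_0.prems have "rec_eval f xs z" by (cases rule: rec_eval.cases) auto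
  then show ?case by (rule PrimRec_0.IH)
next
  case (Comp xs gs ys f y)
  from Comp.prems obtain ys' where ys': "list_all2 (\<lambda>g y. rec_eval g xs y) gs ys'" "rec_eval f ys' z"
    by (cases rule: rec_eval.cases) auto
  have "ys' = ys"
    using Comp.IH(1) ys'(1) by (auto simp: list_all2_conv_all_nth list_eq_iff_nth_eq)
  then show ?case using Comp.IH(2) ys'(2) by simp
next
  case (PrimRec_Suc f g n xs r y)
  from PrimRec_Suc.prems obtain r' where "rec_eval (PrimRec f g) (n # xs) r'" "rec_eval g (n # r' # xs) z"
    by (cases rule: rec_eval.cases) auto
  then show ?case using PrimRec_Suc.IH by metis
next
  case (Mu f n xs)
  from Mu.prems have z: "rec_eval f (z # xs) 0" "\<forall>i<z. \<exists>m>0. rec_eval f (i # xs) m"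
    by (cases rule: rec_eval.cases; auto)+
  show ?case
  proof (cases z n rule: linorder_cases)
    case less
    then show ?thesis using Mu.IH(2) z(1) by fastforce
  next
    case greater
    then show ?thesis using Mu.IH(1) z(2) by fastforce
  qed simp
qed (erule rec_eval.cases; simp; fail)+

text \<open>
  A problem consists of a set \<open>A\<close> of instances, coded by natural numbers through \<open>enc\<close>, and the set
  \<open>P\<close> of positive ones. The decision procedure only has to halt on, and answer
  correctly for, codes of elements of \<open>A\<close>.
\<close>

definition decidable_problem :: "('i \<Rightarrow> nat) \<Rightarrow> 'i set \<Rightarrow> ('i \<Rightarrow> bool) \<Rightarrow> bool" where
  "decidable_problem enc A P \<longleftrightarrow>
    (\<exists>f. \<forall>x\<in>A. rec_eval f [enc x] (if P x then 1 else 0))"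


section \<open>MDPs with chance-interpreted schedulers and mass-interpreted transitions\<close>

definition distributions :: "'x set \<Rightarrow> 'x pmf set" where
  "distributions X = {p. finite (set_pmf p) \<and> set_pmf p \<subseteq> X}"

definition nonempty_seqs :: "'x set \<Rightarrow> 'x list set" where
  "nonempty_seqs X = {p. p \<noteq> [] \<and> set p \<subseteq> X}"

record ('q, 'a) mdp =
  states :: "'q set"
  actions :: "'a set"
  trans :: "'q \<Rightarrow> 'a \<Rightarrow> 'q pmf"

definition is_mdp :: "('q, 'a) mdp \<Rightarrow> bool" where
  "is_mdp M \<longleftrightarrow> finite (states M) \<and> finite (actions M) \<and>
    (\<forall>q\<in>states M. \<forall>a\<in>actions M. trans M q a \<in> distributions (states M))"

abbreviation configs :: "('q, 'a) mdp \<Rightarrow> 'q pmf set" where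
  "configs M \<equiv> distributions (states M)"

text \<open>The configuration $M_a^T d$; see \<open>pmf_successor\<close> for the matrix form.\<close>

definition successor :: "('q, 'a) mdp \<Rightarrow> 'q pmf \<Rightarrow> 'a \<Rightarrow> 'q pmf" where
  "successor M d a = bind_pmf d (\<lambda>q. trans M q a)"

lemma pmf_successor:
  assumes "finite (states M)" "d \<in> configs M"
  shows "pmf (successor M d a) q' = (\<Sum>q\<in>states M. pmf d q * pmf (trans M q a) q')"
  using assms unfolding successor_def pmf_bind distributions_def
  by (subst integral_measure_pmf_real[of "states M"]) (auto simp: mult.commute)

lemma successor_in_configs:
  assumes "is_mdp M" "d \<in> configs M" "a \<in> actions M"
  shows "successor M d a \<in> configs M"
  using assms unfolding successor_def is_mdp_def distributions_def by (auto; blast)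

lemma last_in_configs: "p \<in> nonempty_seqs (configs M) \<Longrightarrow> last p \<in> configs M"
  using last_in_set[of p] by (auto simp: nonempty_seqs_def simp del: last_in_set)

definition scheduler :: "('q, 'a) mdp \<Rightarrow> ('q pmf list \<Rightarrow> 'a pmf) \<Rightarrow> bool" where
  "scheduler M \<sigma> \<longleftrightarrow> (\<forall>p\<in>nonempty_seqs (configs M). \<sigma> p \<in> distributions (actions M))"

definition move_prob ::
  "('q, 'a) mdp \<Rightarrow> ('q pmf list \<Rightarrow> 'a pmf) \<Rightarrow> 'q pmf list \<Rightarrow> 'q pmf \<Rightarrow> real" where
  "move_prob M \<sigma> p d' = (\<Sum>a | a \<in> actions M \<and> d' = successor M (last p) a. pmf (\<sigma> p) a)"

text \<open>
  Infinite sequences of configurations carry the product of the discrete $\sigma$-algebras, so that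
  reaching an arbitrary set of configurations is an event. Only countably many finite histories
  have positive probability, hence the probabilities of the cylinders still determine the measure
  (\<open>ex1_induced_measure\<close>).
\<close>

definition path_space :: "('q, 'a) mdp \<Rightarrow> (nat \<Rightarrow> 'q pmf) measure" where
  "path_space M = PiM UNIV (\<lambda>_. count_space (configs M))"

definition cylinder :: "('q, 'a) mdp \<Rightarrow> 'q pmf list \<Rightarrow> (nat \<Rightarrow> 'q pmf) set" where
  "cylinder M p = {\<omega> \<in> space (path_space M). \<forall>i<length p. \<omega> i = p ! i}"

definition induced_measure ::
  "('q, 'a) mdp \<Rightarrow> ('q pmf list \<Rightarrow> 'a pmf) \<Rightarrow> 'q pmf \<Rightarrow> (nat \<Rightarrow> 'q pmf) measure \<Rightarrow> bool" where
  "induced_measure M \<sigma> d0 P \<longleftrightarrow>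
    prob_space P \<and> sets P = sets (path_space M) \<and>
    measure P (cylinder M [d0]) = 1 \<and>
    (\<forall>p\<in>nonempty_seqs (configs M). \<forall>d'\<in>configs M.
      measure P (cylinder M (p @ [d'])) = measure P (cylinder M p) * move_prob M \<sigma> p d')"

definition path_measure ::
  "('q, 'a) mdp \<Rightarrow> ('q pmf list \<Rightarrow> 'a pmf) \<Rightarrow> 'q pmf \<Rightarrow> (nat \<Rightarrow> 'q pmf) measure" where
  "path_measure M \<sigma> d0 = (THE P. induced_measure M \<sigma> d0 P)"

text \<open>
  A configuration is identified with the vector in $[0,1]^Q$ it defines; vectors are functions
  that are \<open>undefined\<close> outside \<open>Q\<close>.
\<close>

definition cube :: "'q set \<Rightarrow> ('q \<Rightarrow> real) set" where
  "cube Q = Q \<rightarrow>\<^sub>E {0..1}"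

definition config_vec :: "'q set \<Rightarrow> 'q pmf \<Rightarrow> 'q \<Rightarrow> real" where
  "config_vec Q d = restrict (pmf d) Q"

definition Reach :: "('q, 'a) mdp \<Rightarrow> 'q pmf \<Rightarrow> ('q \<Rightarrow> real) set \<Rightarrow> (nat \<Rightarrow> 'q pmf) set" where
  "Reach M d0 H = {\<omega> \<in> space (path_space M). \<omega> 0 = d0 \<and> (\<exists>i. config_vec (states M) (\<omega> i) \<in> H)}"


subsection \<open>Existence and uniqueness of the induced measure\<close>

lemma space_path_space: "space (path_space M) = {\<omega>. \<forall>i. \<omega> i \<in> configs M}"
  by (auto simp: path_space_def space_PiM)

lemma measurable_coordinate: "A \<subseteq> configs M \<Longrightarrow> {\<omega> \<in> space (path_space M). \<omega> i \<in> A} \<in> sets (path_space M)"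
  unfolding path_space_def by (rule sets_Collect_single') (auto intro!: arg_cong2[where f = "(\<in>)"])

lemma cylinder_sets: "cylinder M p \<in> sets (path_space M)"
proof -
  have *: "{\<omega> \<in> space (path_space M). \<omega> i = d} \<in> sets (path_space M)" for i d
  proof -
    have "{\<omega> \<in> space (path_space M). \<omega> i = d} = {\<omega> \<in> space (path_space M). \<omega> i \<in> {d} \<inter> configs M}"
      by (auto simp: space_path_space)
    then show ?thesis using measurable_coordinate[of "{d} \<inter> configs M" M i] by simp
  qed
  have "cylinder M p = {\<omega> \<in> space (path_space M). \<forall>i\<in>{..<length p}. \<omega> i = p ! i}"
    by (auto simp: cylinder_def)
  also have "\<dots> \<in> sets (path_space M)"
    by (rule sets.sets_Collect_finite_All) (use * in auto)
  finally show ?thesis .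
qed

lemma Reach_sets: "Reach M d0 H \<in> sets (path_space M)"
proof -
  have *: "{\<omega> \<in> space (path_space M). config_vec (states M) (\<omega> i) \<in> H} \<in> sets (path_space M)" for i
  proof -
    have "{\<omega> \<in> space (path_space M). config_vec (states M) (\<omega> i) \<in> H} =
      {\<omega> \<in> space (path_space M). \<omega> i \<in> {d \<in> configs M. config_vec (states M) d \<in> H}}"
      by (auto simp: space_path_space)
    then show ?thesis using measurable_coordinate[of "{d \<in> configs M. config_vec (states M) d \<in> H}" M i] by simp
  qed
  have "Reach M d0 H = cylinder M [d0] \<inter> (\<Union>i. {\<omega> \<in> space (path_space M). config_vec (states M) (\<omega> i) \<in> H})"
    by (auto simp: Reach_def cylinder_def)
  also have "\<dots> \<in> sets (path_space M)"
    by (intro sets.Int sets.countable_UN) (use * cylinder_sets in auto)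
  finally show ?thesis .
qed

lemma cylinder_disjoint:
  assumes "length p = length p'" "p \<noteq> p'"
  shows "cylinder M p \<inter> cylinder M p' = {}"
  using assms by (auto simp: cylinder_def list_eq_iff_nth_eq)

primrec reachable_histories :: "('q, 'a) mdp \<Rightarrow> 'q pmf \<Rightarrow> nat \<Rightarrow> 'q pmf list set" where
  "reachable_histories M d0 0 = {[d0]}"
| "reachable_histories M d0 (Suc k) =
    (\<lambda>(p, d). p @ [d]) ` (SIGMA p : reachable_histories M d0 k. successor M (last p) ` actions M)"

lemma reachable_histories:
  assumes "is_mdp M" "d0 \<in> configs M"
  shows "finite (reachable_histories M d0 k)"
    and "p \<in> reachable_histories M d0 k \<Longrightarrow> length p = Suc k \<and> p \<in> nonempty_seqs (configs M)"
proof -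
  have "finite (reachable_histories M d0 k) \<and>
    (\<forall>p\<in>reachable_histories M d0 k. length p = Suc k \<and> p \<in> nonempty_seqs (configs M))"
  proof (induction k)
    case 0
    then show ?case using assms by (auto simp: nonempty_seqs_def)
  next
    case (Suc k)
    have fin: "finite (actions M)" using assms by (simp add: is_mdp_def)
    have "p @ [successor M (last p) a] \<in> nonempty_seqs (configs M)"
      if "p \<in> reachable_histories M d0 k" "a \<in> actions M" for p a
    proof -
      have "last p \<in> configs M" using Suc that by (intro last_in_configs) auto
      with that(2) assms have "successor M (last p) a \<in> configs M" by (simp add: successor_in_configs)
      then show ?thesis using Suc that by (auto simp: nonempty_seqs_def)
    qed
    then show ?case using Suc fin by (auto intro!: finite_imageI finite_SigmaI)
  qed
  then show "finite (reachable_histories M d0 k)"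
    and "p \<in> reachable_histories M d0 k \<Longrightarrow> length p = Suc k \<and> p \<in> nonempty_seqs (configs M)"
    by auto
qed

lemma sum_move_prob:
  assumes "is_mdp M" "scheduler M \<sigma>" "p \<in> nonempty_seqs (configs M)"
  shows "(\<Sum>d\<in>successor M (last p) ` actions M. move_prob M \<sigma> p d) = 1"
proof -
  have fin: "finite (actions M)" using assms by (simp add: is_mdp_def)
  have "(\<Sum>d\<in>successor M (last p) ` actions M. move_prob M \<sigma> p d) = (\<Sum>a\<in>actions M. pmf (\<sigma> p) a)"
    unfolding move_prob_def
    by (subst sum.image_gen[OF fin, of _ "successor M (last p)"]) (simp add: eq_commute conj_commute)
  also have "\<dots> = 1"
    using assms fin by (intro sum_pmf_eq_1) (auto simp: scheduler_def distributions_def)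
  finally show ?thesis .
qed

lemma induced_measure_support:
  assumes M: "is_mdp M" "scheduler M \<sigma>" "d0 \<in> configs M" and P: "induced_measure M \<sigma> d0 P"
  shows "(\<Sum>p\<in>reachable_histories M d0 k. measure P (cylinder M p)) = 1"
proof (induction k)
  case 0
  then show ?case using P by (simp add: induced_measure_def)
next
  case (Suc k)
  let ?R = "reachable_histories M d0 k" and ?S = "\<lambda>p. successor M (last p) ` actions M"
  have fin: "finite (actions M)" using M by (simp add: is_mdp_def)
  have "(\<Sum>p\<in>reachable_histories M d0 (Suc k). measure P (cylinder M p)) =
    (\<Sum>(p, d)\<in>(SIGMA p:?R. ?S p). measure P (cylinder M (p @ [d])))"
    by (simp add: sum.reindex inj_on_def case_prod_unfold)
  also have "\<dots> = (\<Sum>p\<in>?R. \<Sum>d\<in>?S p. measure P (cylinder M (p @ [d])))"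
    using reachable_histories[OF M(1,3)] fin by (subst sum.Sigma) auto
  also have "\<dots> = (\<Sum>p\<in>?R. \<Sum>d\<in>?S p. measure P (cylinder M p) * move_prob M \<sigma> p d)"
  proof (intro sum.cong refl)
    fix p d assume p: "p \<in> ?R" and d: "d \<in> ?S p"
    then have *: "p \<in> nonempty_seqs (configs M)" using reachable_histories[OF M(1,3)] by auto
    then have "last p \<in> configs M" by (rule last_in_configs)
    then have "d \<in> configs M" using d M by (auto simp: successor_in_configs)
    with * P show "measure P (cylinder M (p @ [d])) = measure P (cylinder M p) * move_prob M \<sigma> p d"
      by (simp add: induced_measure_def)
  qed
  also have "\<dots> = (\<Sum>p\<in>?R. measure P (cylinder M p))"
    using reachable_histories[OF M(1,3)] sum_move_prob[OF M(1,2)]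
    by (intro sum.cong refl) (simp flip: sum_distrib_left)
  finally show ?case using Suc by simp
qed

lemma induced_measure_cylinder_unique:
  assumes M: "is_mdp M" "scheduler M \<sigma>" "d0 \<in> configs M"
    and P: "induced_measure M \<sigma> d0 P" and P': "induced_measure M \<sigma> d0 P'"
  shows "p \<in> reachable_histories M d0 k \<Longrightarrow> measure P (cylinder M p) = measure P' (cylinder M p)"
proof (induction k arbitrary: p)
  case 0
  then show ?case using P P' by (simp add: induced_measure_def)
next
  case (Suc k)
  then obtain q a where q: "q \<in> reachable_histories M d0 k" "a \<in> actions M"
    "p = q @ [successor M (last q) a]" by auto
  then have *: "q \<in> nonempty_seqs (configs M)" using reachable_histories[OF M(1,3)] by auto
  then have "last q \<in> configs M" by (rule last_in_configs)
  then have "successor M (last q) a \<in> configs M" using q M by (auto simp: successor_in_configs)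
  with * P P' Suc.IH[OF q(1)] show ?case unfolding q(3) by (simp add: induced_measure_def)
qed

lemma induced_measure_unique:
  assumes M: "is_mdp M" "scheduler M \<sigma>" "d0 \<in> configs M"
    and P: "induced_measure M \<sigma> d0 P" and P': "induced_measure M \<sigma> d0 P'"
  shows "P = P'"
proof (rule measure_eqI_PiM_infinite)
  show "sets P = sets (PiM UNIV (\<lambda>_. count_space (configs M)))"
    and "sets P' = sets (PiM UNIV (\<lambda>_. count_space (configs M)))"
    using P P' by (simp_all add: induced_measure_def path_space_def)
  have prob: "prob_space P" "prob_space P'" using P P' by (simp_all add: induced_measure_def)
  then show "finite_measure P" by (simp add: prob_space.finite_measure)
  fix A :: "nat \<Rightarrow> 'a pmf set" and J :: "nat set"
  assume J: "finite J" "J \<subseteq> UNIV" and A: "\<And>i. i \<in> J \<Longrightarrow> A i \<in> sets (count_space (configs M))"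
  let ?E = "prod_emb UNIV (\<lambda>_. count_space (configs M)) J (Pi\<^sub>E J A)"
  have E: "?E = {\<omega> \<in> space (path_space M). \<forall>j\<in>J. \<omega> j \<in> A j}"
    by (auto simp: prod_emb_def path_space_def space_PiM)
  have E_sets: "?E \<in> sets (path_space M)"
    unfolding path_space_def using J A by (intro sets_PiM_I) auto
  obtain k where k: "J \<subseteq> {..k}" using J(1) by (meson finite_nat_iff_bounded_le)
  define R where "R = reachable_histories M d0 k"
  define good where "good = {p \<in> R. \<forall>j\<in>J. p ! j \<in> A j}"
  have R: "finite R" "\<And>p. p \<in> R \<Longrightarrow> length p = Suc k"
    using reachable_histories[OF M(1,3)] by (auto simp: R_def)
  have key: "measure N ?E = (\<Sum>p\<in>good. measure N (cylinder M p))" if N: "induced_measure M \<sigma> d0 N" for N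
  proof -
    interpret N: prob_space N using N by (simp add: induced_measure_def)
    have sN: "sets N = sets (path_space M)" using N by (simp add: induced_measure_def)
    have disj: "disjoint_family_on (cylinder M) R"
      using R(2) cylinder_disjoint unfolding disjoint_family_on_def by metis
    have "measure N (\<Union>p\<in>R. cylinder M p) = 1"
      using induced_measure_support[OF M N, of k] R disj cylinder_sets
      by (subst N.finite_measure_finite_Union) (auto simp: R_def sN)
    then have AE: "AE \<omega> in N. \<omega> \<in> (\<Union>p\<in>R. cylinder M p)"
      using R cylinder_sets sN by (subst (asm) N.prob_eq_1) (auto intro!: sets.finite_UN)
    have eq: "(\<Union>p\<in>good. cylinder M p) = ?E \<inter> (\<Union>p\<in>R. cylinder M p)"
    proof -
      have *: "\<omega> j = p ! j" if "j \<in> J" "p \<in> R" "\<omega> \<in> cylinder M p" for j p \<omega>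
        using that k R(2) by (auto simp: cylinder_def subset_iff less_Suc_eq_le)
      have "p \<in> good \<longleftrightarrow> \<omega> \<in> ?E" if "p \<in> R" "\<omega> \<in> cylinder M p" for p \<omega>
      proof -
        have "\<omega> \<in> space (path_space M)" using that by (simp add: cylinder_def)
        then show ?thesis using that *[OF _ that] by (simp add: good_def E)
      qed
      moreover have "good \<subseteq> R" by (auto simp: good_def)
      ultimately show ?thesis by blast
    qed
    have "measure N ?E = measure N (\<Union>p\<in>good. cylinder M p)"
    proof (rule N.finite_measure_eq_AE)
      show "AE \<omega> in N. (\<omega> \<in> ?E) = (\<omega> \<in> (\<Union>p\<in>good. cylinder M p))"
        using AE by eventually_elim (simp add: eq)
      show "?E \<in> sets N" using E_sets sN by simp
      show "(\<Union>p\<in>good. cylinder M p) \<in> sets N"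
        using R cylinder_sets sN by (auto simp: good_def intro!: sets.finite_UN)
    qed
    also have "\<dots> = (\<Sum>p\<in>good. measure N (cylinder M p))"
      using R disj cylinder_sets
      by (intro N.finite_measure_finite_Union)
        (auto simp: good_def sN intro: disjoint_family_on_mono[rotated])
    finally show ?thesis .
  qed
  have "measure P ?E = measure P' ?E"
    unfolding key[OF P] key[OF P']
    by (intro sum.cong refl induced_measure_cylinder_unique[OF M P P', of _ k]) (auto simp: good_def R_def)
  then show "emeasure P ?E = emeasure P' ?E"
    using prob by (simp add: finite_measure.emeasure_eq_measure prob_space.finite_measure)
qed

text \<open>
  For existence, draw an action for every history independently and read off the resulting
  sequence of configurations. Actions outside \<open>actions M\<close> occur with probability zero; they leave
  the configuration unchanged.
\<close>

definition next_config :: "('q, 'a) mdp \<Rightarrow> 'q pmf \<Rightarrow> 'a \<Rightarrow> 'q pmf" where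
  "next_config M d a = (if a \<in> actions M then successor M d a else d)"

primrec run :: "('q, 'a) mdp \<Rightarrow> 'q pmf \<Rightarrow> ('q pmf list \<Rightarrow> 'a) \<Rightarrow> nat \<Rightarrow> 'q pmf list" where
  "run M d0 c 0 = [d0]"
| "run M d0 c (Suc k) = run M d0 c k @ [next_config M (last (run M d0 c k)) (c (run M d0 c k))]"

lemma length_run [simp]: "length (run M d0 c k) = Suc k"
  by (induction k) auto

lemma run_nonempty [simp]: "run M d0 c k \<noteq> []"
  by (metis length_run length_0_conv nat.distinct(1))

lemma run_configs:
  assumes "is_mdp M" "d0 \<in> configs M"
  shows "set (run M d0 c k) \<subseteq> configs M"
proof (induction k)
  case (Suc k)
  then have "last (run M d0 c k) \<in> configs M" by (meson last_in_set run_nonempty subsetD)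
  then have "next_config M (last (run M d0 c k)) a \<in> configs M" for a
    using assms by (simp add: next_config_def successor_in_configs)
  with Suc show ?case by simp
qed (use assms in simp)

lemma run_nth: "i \<le> k \<Longrightarrow> run M d0 c k ! i = last (run M d0 c i)"
  by (induction k) (auto simp: nth_append le_Suc_eq last_conv_nth)

lemma run_eq_iff:
  assumes "length p = Suc k"
  shows "run M d0 c k = p \<longleftrightarrow> (\<forall>i\<le>k. last (run M d0 c i) = p ! i)"
proof -
  have "run M d0 c k = p \<longleftrightarrow> (\<forall>i<Suc k. run M d0 c k ! i = p ! i)"
    using assms by (auto simp: list_eq_iff_nth_eq)
  then show ?thesis by (auto simp: run_nth less_Suc_eq_le)
qed

lemma run_eq_iff_choices:
  assumes "length p = Suc k"
  shows "run M d0 c k = p \<longleftrightarrow> p ! 0 = d0 \<and>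
    (\<forall>i<k. next_config M (p ! i) (c (take (Suc i) p)) = p ! Suc i)"
  using assms
proof (induction k arbitrary: p)
  case 0
  then show ?case by (auto simp: length_Suc_conv)
next
  case (Suc k)
  then obtain q d where p: "p = q @ [d]" and q: "length q = Suc k"
    by (metis append_butlast_last_id length_butlast diff_Suc_1 list.size(3) nat.distinct(1))
  have l: "last q = q ! k" using q by (metis diff_Suc_1 last_conv_nth list.size(3) nat.distinct(1))
  have "run M d0 c (Suc k) = p \<longleftrightarrow> run M d0 c k = q \<and> next_config M (last q) (c q) = d"
    by (auto simp: p)
  also have "\<dots> \<longleftrightarrow> p ! 0 = d0 \<and> (\<forall>i<Suc k. next_config M (p ! i) (c (take (Suc i) p)) = p ! Suc i)"
  proof -
    have "p ! 0 = q ! 0" "p ! k = last q" "p ! Suc k = d" "take (Suc k) p = q"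
      using q by (simp_all add: p l nth_append)
    moreover have "p ! i = q ! i" "p ! Suc i = q ! Suc i" "take (Suc i) p = take (Suc i) q" if "i < k" for i
      using q that by (simp_all add: p nth_append)
    ultimately show ?thesis
      unfolding Suc.IH[OF q] All_less_Suc by (simp cong: imp_cong conj_cong) blast
  qed
  finally show ?case .
qed

lemma induced_measure_exists:
  assumes M: "is_mdp M" "scheduler M \<sigma>" "d0 \<in> configs M"
  shows "\<exists>P. induced_measure M \<sigma> d0 P"
proof -
  let ?N = "PiM UNIV (\<lambda>p. measure_pmf (\<sigma> p))"
  let ?X = "\<lambda>c k. last (run M d0 c k)"
  interpret N: product_prob_space "\<lambda>p. measure_pmf (\<sigma> p)" UNIV ..
  have space_N: "space ?N = UNIV" by (simp add: space_PiM)
  have fin: "finite (actions M)" using M by (simp add: is_mdp_def)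
  define B where "B p q = {a. next_config M (last q) a = p ! length q}" for p q
  define J where "J p = (\<lambda>i. take (Suc i) p) ` {..<length p - 1}" for p :: "'a pmf list"
  have ev: "{c. run M d0 c k = p} =
      (if p ! 0 = d0 then prod_emb UNIV (\<lambda>p. measure_pmf (\<sigma> p)) (J p) (Pi\<^sub>E (J p) (B p)) else {})"
    if p: "length p = Suc k" for p k
  proof -
    have "last (take (Suc i) p) = p ! i \<and> length (take (Suc i) p) = Suc i" if "i < k" for i
      using that p by (simp add: take_Suc_conv_app_nth)
    then have "c \<in> prod_emb UNIV (\<lambda>p. measure_pmf (\<sigma> p)) (J p) (Pi\<^sub>E (J p) (B p)) \<longleftrightarrow>
        (\<forall>i<k. next_config M (p ! i) (c (take (Suc i) p)) = p ! Suc i)" for c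
      using p by (simp add: prod_emb_def J_def B_def PiE_iff space_PiM Ball_def) (auto simp: image_iff)
    then show ?thesis
      using run_eq_iff_choices[OF p, of M d0] by auto
  qed
  have finJ: "finite (J p)" for p by (simp add: J_def)
  have ev_sets: "{c. run M d0 c k = p} \<in> sets ?N" if p: "length p = Suc k" for p k
    unfolding ev[OF p] using finJ by (auto intro!: sets_PiM_I)
  have ev_prob: "measure ?N {c. run M d0 c k = p} =
      (if p ! 0 = d0 then \<Prod>q\<in>J p. measure (measure_pmf (\<sigma> q)) (B p q) else 0)"
    if p: "length p = Suc k" for p k
    unfolding ev[OF p] using finJ by (auto intro!: N.measure_PiM_emb)
  have range_fin: "finite (range (\<lambda>c. run M d0 c k))" for k
  proof (induction k)
    case (Suc k)
    have "range (\<lambda>c. run M d0 c (Suc k)) \<subseteq>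
      (\<lambda>(p, d). p @ [d]) ` (SIGMA p : range (\<lambda>c. run M d0 c k). insert (last p) (successor M (last p) ` actions M))"
      by (auto simp: next_config_def image_iff)
    then show ?case
      by (rule finite_subset) (use Suc fin in \<open>auto intro!: finite_imageI finite_SigmaI\<close>)
  qed simp
  have meas: "?X \<in> measurable ?N (path_space M)"
    unfolding path_space_def
  proof (rule measurable_PiM_single')
    have X: "?X c k \<in> configs M" for c k
      using run_configs[OF M(1,3), of c k] last_in_set[OF run_nonempty, of M d0 c k] by auto
    then show "?X \<in> space ?N \<rightarrow> UNIV \<rightarrow>\<^sub>E space (count_space (configs M))"
      by auto
    show "(\<lambda>c. ?X c k) \<in> measurable ?N (count_space (configs M))" for k
    proof (rule measurableI)
      show "?X c k \<in> space (count_space (configs M))" for c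
        using X by simp
      fix A :: "'a pmf set"
      have "(\<lambda>c. ?X c k) -` A \<inter> space ?N =
        (\<Union>p\<in>{p \<in> range (\<lambda>c. run M d0 c k). last p \<in> A}. {c. run M d0 c k = p})"
        by (auto simp: space_N)
      also have "\<dots> \<in> sets ?N"
        using range_fin by (intro sets.finite_UN) (auto intro!: ev_sets)
      finally show "(\<lambda>c. ?X c k) -` A \<inter> space ?N \<in> sets ?N" .
    qed
  qed
  define P where "P = distr ?N (path_space M) ?X"
  have cyl: "measure P (cylinder M p) = measure ?N {c. run M d0 c k = p}" if p: "length p = Suc k" for p k
  proof -
    have "?X -` cylinder M p \<inter> space ?N = {c. run M d0 c k = p}"
      using p measurable_space[OF meas]
      by (auto simp: cylinder_def run_eq_iff[OF p] space_N less_Suc_eq_le)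
    then show ?thesis by (simp only: P_def measure_distr[OF meas cylinder_sets])
  qed
  have "induced_measure M \<sigma> d0 P"
    unfolding induced_measure_def
  proof (intro conjI ballI)
    show "prob_space P" unfolding P_def by (rule N.P.prob_space_distr[OF meas])
    show "sets P = sets (path_space M)" by (simp add: P_def)
    have "measure P (cylinder M [d0]) = measure ?N (space ?N)"
      by (subst cyl[of _ 0]) (simp_all add: space_N)
    then show "measure P (cylinder M [d0]) = 1" by (simp add: N.P.prob_space)
    fix p d assume p: "p \<in> nonempty_seqs (configs M)" and d: "d \<in> configs M"
    then obtain k where k: "length p = Suc k"
      by (cases p) (auto simp: nonempty_seqs_def)
    have p0: "(p @ [d]) ! 0 = p ! 0" using k by (simp add: nth_append)
    have J: "J (p @ [d]) = insert p (J p)"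
      using k by (auto simp: J_def lessThan_Suc)
    have notin: "p \<notin> J p"
    proof
      assume "p \<in> J p"
      then obtain i where "i < k" "p = take (Suc i) p" using k by (auto simp: J_def)
      then show False using k by (metis length_take min.absorb4 Suc_less_eq nat_neq_iff)
    qed
    have BJ: "B (p @ [d]) q = B p q" if "q \<in> J p" for q
      using that k by (auto simp: J_def B_def nth_append)
    have "B (p @ [d]) p = {a. next_config M (last p) a = d}" by (simp add: B_def)
    moreover have "set_pmf (\<sigma> p) \<subseteq> actions M"
      using M(2) p by (auto simp: scheduler_def distributions_def)
    then have "measure (measure_pmf (\<sigma> p)) {a. next_config M (last p) a = d} =
        measure (measure_pmf (\<sigma> p)) {a \<in> actions M. d = successor M (last p) a}"
      by (intro measure_pmf.finite_measure_eq_AE) (auto simp: AE_measure_pmf_iff next_config_def)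
    ultimately have step: "measure (measure_pmf (\<sigma> p)) (B (p @ [d]) p) = move_prob M \<sigma> p d"
      using fin by (simp add: move_prob_def measure_measure_pmf_finite)
    have k': "length (p @ [d]) = Suc (Suc k)" using k by simp
    have "(\<Prod>q\<in>J (p @ [d]). measure (measure_pmf (\<sigma> q)) (B (p @ [d]) q)) =
        (\<Prod>q\<in>J p. measure (measure_pmf (\<sigma> q)) (B p q)) * move_prob M \<sigma> p d"
      unfolding J prod.insert[OF finJ notin] step using BJ by (simp cong: prod.cong)
    then show "measure P (cylinder M (p @ [d])) = measure P (cylinder M p) * move_prob M \<sigma> p d"
      unfolding cyl[OF k'] cyl[OF k] ev_prob[OF k'] ev_prob[OF k] p0 by simp
  qed
  then show ?thesis by blast
qed

lemma ex1_induced_measure: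
  assumes "is_mdp M" "scheduler M \<sigma>" "d0 \<in> configs M"
  shows "\<exists>!P. induced_measure M \<sigma> d0 P"
  using induced_measure_exists[OF assms] induced_measure_unique[OF assms] by blast

lemma path_measure:
  assumes "is_mdp M" "scheduler M \<sigma>" "d0 \<in> configs M"
  shows "induced_measure M \<sigma> d0 (path_measure M \<sigma> d0)"
  unfolding path_measure_def by (rule theI'[OF ex1_induced_measure[OF assms]])


section \<open>Finitely generated monotone sets\<close>

definition upward_closed :: "'q set \<Rightarrow> ('q \<Rightarrow> real) set \<Rightarrow> bool" where
  "upward_closed Q H \<longleftrightarrow> H \<subseteq> cube Q \<and>
    (\<forall>x\<in>H. \<forall>y\<in>cube Q. (\<forall>q\<in>Q. x q \<le> y q) \<longrightarrow> y \<in> H)"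

definition downward_closed :: "'q set \<Rightarrow> ('q \<Rightarrow> real) set \<Rightarrow> bool" where
  "downward_closed Q H \<longleftrightarrow> H \<subseteq> cube Q \<and>
    (\<forall>x\<in>H. \<forall>y\<in>cube Q. (\<forall>q\<in>Q. y q \<le> x q) \<longrightarrow> y \<in> H)"

definition up_closure :: "'q set \<Rightarrow> ('q \<Rightarrow> real) set \<Rightarrow> ('q \<Rightarrow> real) set" where
  "up_closure Q T = {y \<in> cube Q. \<exists>x\<in>T. \<forall>q\<in>Q. x q \<le> y q}"

definition down_closure :: "'q set \<Rightarrow> ('q \<Rightarrow> real) set \<Rightarrow> ('q \<Rightarrow> real) set" where
  "down_closure Q T = {y \<in> cube Q. \<exists>x\<in>T. \<forall>q\<in>Q. y q \<le> x q}"

definition fin_gen_monotone :: "'q set \<Rightarrow> ('q \<Rightarrow> real) set \<Rightarrow> bool" where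
  "fin_gen_monotone Q H \<longleftrightarrow>
    (upward_closed Q H \<and> (\<exists>T. finite T \<and> T \<subseteq> cube Q \<and> H = up_closure Q T)) \<or>
    (downward_closed Q H \<and> (\<exists>T. finite T \<and> T \<subseteq> cube Q \<and> H = down_closure Q T))"

lemma upward_closed_up_closure: "upward_closed Q (up_closure Q T)"
  unfolding upward_closed_def up_closure_def by auto (meson order_trans)

lemma downward_closed_down_closure: "downward_closed Q (down_closure Q T)"
  unfolding downward_closed_def down_closure_def by auto (meson order_trans)


section \<open>Instances with rational data\<close>

text \<open>
  All numbers of an instance lie in $[0,1]$ and are given as fractions (numerator, denominator),
  not necessarily in lowest terms. The states are $0,\dots,n-1$ and the actions $0,\dots,m-1$.
\<close>

type_synonym frac = "nat \<times> nat"

definition frac_val :: "frac \<Rightarrow> real" where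
  "frac_val r = real (fst r) / real (snd r)"

definition valid_frac :: "frac \<Rightarrow> bool" where
  "valid_frac r \<longleftrightarrow> snd r > 0 \<and> fst r \<le> snd r"

text \<open>
  \<open>trans_table I ! q ! a ! q'\<close> is the probability of moving from \<open>q\<close> to \<open>q'\<close> under \<open>a\<close>;
  \<open>upward I\<close> tells whether \<open>generators I\<close> generates an upward-closed or a downward-closed set.
\<close>

record reach_instance =
  num_states :: nat
  num_actions :: nat
  trans_table :: "frac list list list"
  init_table :: "frac list"
  upward :: bool
  generators :: "frac list list"
  threshold :: frac

definition valid_vec :: "nat \<Rightarrow> frac list \<Rightarrow> bool" where
  "valid_vec n v \<longleftrightarrow> length v = n \<and> (\<forall>r\<in>set v. valid_frac r)"

definition valid_distr :: "nat \<Rightarrow> frac list \<Rightarrow> bool" where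
  "valid_distr n v \<longleftrightarrow> valid_vec n v \<and> (\<Sum>r\<leftarrow>v. frac_val r) = 1"

definition valid_instance :: "reach_instance \<Rightarrow> bool" where
  "valid_instance I \<longleftrightarrow>
    length (trans_table I) = num_states I \<and>
    (\<forall>row\<in>set (trans_table I). length row = num_actions I \<and>
      (\<forall>v\<in>set row. valid_distr (num_states I) v)) \<and>
    valid_distr (num_states I) (init_table I) \<and>
    (\<forall>v\<in>set (generators I). valid_vec (num_states I) v) \<and>
    valid_frac (threshold I)"

definition distr_of :: "frac list \<Rightarrow> nat pmf" where
  "distr_of v = pmf_of_list (List.enumerate 0 (map frac_val v))"

definition vec_of :: "frac list \<Rightarrow> nat \<Rightarrow> real" where
  "vec_of v = restrict (\<lambda>q. frac_val (v ! q)) {..<length v}"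

definition mdp_of :: "reach_instance \<Rightarrow> (nat, nat) mdp" where
  "mdp_of I = \<lparr>states = {..<num_states I}, actions = {..<num_actions I},
    trans = (\<lambda>q a. distr_of (trans_table I ! q ! a))\<rparr>"

definition init_of :: "reach_instance \<Rightarrow> nat pmf" where
  "init_of I = distr_of (init_table I)"

definition target_of :: "reach_instance \<Rightarrow> (nat \<Rightarrow> real) set" where
  "target_of I = (if upward I then up_closure else down_closure)
    {..<num_states I} (vec_of ` set (generators I))"

definition frac_encode :: "frac \<Rightarrow> nat" where
  "frac_encode = prod_encode"

definition vec_encode :: "frac list \<Rightarrow> nat" where
  "vec_encode v = list_encode (map frac_encode v)"

definition instance_encode :: "reach_instance \<Rightarrow> nat" where
  "instance_encode I = list_encode
    [num_states I,
     num_actions I,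
     list_encode (map (\<lambda>row. list_encode (map vec_encode row)) (trans_table I)),
     vec_encode (init_table I),
     of_bool (upward I),
     list_encode (map vec_encode (generators I)),
     frac_encode (threshold I)]"

lemma inj_vec_encode: "inj vec_encode"
  unfolding vec_encode_def frac_encode_def
  by (rule injI) (simp add: list_encode_eq inj_map_eq_map inj_prod_encode)

lemma inj_instance_encode: "inj instance_encode"
proof -
  have "inj (\<lambda>row. list_encode (map vec_encode row))"
    by (rule injI) (simp add: list_encode_eq inj_map_eq_map inj_vec_encode)
  then show ?thesis
    by (intro injI)
      (auto simp: instance_encode_def frac_encode_def list_encode_eq inj_map_eq_map inj_vec_encode
        prod_encode_eq inj_eq[OF inj_vec_encode] of_bool_eq_iff intro!: reach_instance.equality)
qed

lemma pmf_distr_of: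
  assumes "valid_distr n v"
  shows "pmf (distr_of v) q = (if q < n then frac_val (v ! q) else 0)"
proof -
  have wf: "pmf_of_list_wf (List.enumerate 0 (map frac_val v))"
    using assms by (auto simp: pmf_of_list_wf_def valid_distr_def) (simp add: frac_val_def)
  have *: "sum_list (map snd (filter (\<lambda>z. fst z = q) (List.enumerate k xs))) =
      (if k \<le> q \<and> q < k + length xs then xs ! (q - k) else 0)" for k and xs :: "real list"
  proof (induction xs arbitrary: k)
    case (Cons x xs)
    show ?case
    proof (cases "q = k")
      case True
      then show ?thesis using Cons.IH[of "Suc k"] by simp
    next
      case False
      then have "k \<le> q \<longleftrightarrow> Suc k \<le> q" by auto
      with False show ?thesis by (auto simp: Cons.IH nth_Cons' Suc_diff_Suc)
    qed
  qed simp
  from * [of 0 "map frac_val v"] show ?thesis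
    using assms by (simp add: distr_of_def pmf_pmf_of_list[OF wf] valid_distr_def valid_vec_def)
qed

lemma distr_of_distribution:
  assumes "valid_distr n v"
  shows "distr_of v \<in> distributions {..<n}"
proof -
  have "set_pmf (distr_of v) \<subseteq> {..<n}"
    by (auto simp: set_pmf_iff pmf_distr_of[OF assms] split: if_splits)
  then show ?thesis by (auto simp: distributions_def intro: finite_subset)
qed

lemma valid_instance_mdp:
  assumes "valid_instance I"
  shows "is_mdp (mdp_of I)" "init_of I \<in> configs (mdp_of I)"
  using assms
  by (auto simp: is_mdp_def mdp_of_def init_of_def valid_instance_def all_set_conv_all_nth
      intro!: distr_of_distribution)

lemma valid_instance_target:
  assumes "valid_instance I"
  shows "fin_gen_monotone (states (mdp_of I)) (target_of I)"
proof -
  have "vec_of v \<in> cube {..<num_states I}" if "v \<in> set (generators I)" for v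
    using assms that
    by (auto simp: valid_instance_def valid_vec_def vec_of_def cube_def frac_val_def valid_frac_def)
  then have "vec_of ` set (generators I) \<subseteq> cube {..<num_states I}" by blast
  then show ?thesis
    by (auto simp: fin_gen_monotone_def target_of_def mdp_of_def
        intro: upward_closed_up_closure downward_closed_down_closure)
qed

end

theory Submission
  imports Defs
begin

text \<open>
  With threshold 1, a scheduler as required exists iff some word of actions leads
  deterministically from the initial configuration into the target. Along a word the masses of the
  states evolve linearly, which suffices to simulate counters that may become negative: a counter
  with value $c$ is kept as the masses $m$, $m x$ and $m x^2$ with $x = 2^{-c}$. A zero test moves a
  multiple of $m(1 - x)^2 \ge 0$ from the accepting to the rejecting state, so that half of the mass
  is accepted in the end iff all tests of the word were correct. The choice of the word supplies
  the nondeterminism.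
  Nonnegativity of a counter is tested by counting it down to zero, and such nondeterministic
  programs can check the graph of every partial recursive function. A decision procedure
  is refuted by diagonalisation: only the initial distribution depends on the input of the
  simulated function, so no universal machine is needed.
\<close>

section \<open>Programs for partial recursive functions\<close>

text \<open>Where a counter is negative, $x > 1$, so a penalty proportional to $1 - x$ could be
  offset by a later error of the opposite sign. Squares cannot cancel, and $(1 - x)^2$ is linear in
  the configuration once $m x^2$ is carried along with $m x$. Counting down doubles $x$ and
  quadruples $x^2$, while mass cannot be created; hence every action shrinks all three masses by a
  common factor, and the value of $m$ is left open. This is harmless, as only the vanishing of the
  penalties matters, never their size. A failed test can never be made up for: the difference
  between accepted and rejected mass starts at 0 and never grows. As long as some mass is undecided,
  less than half is accepted, so the target is out of reach until a final action has distributed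
  everything.

  The diagonal instance has to contain a machine that is built from the supposed decision procedure.
  The circularity disappears because every machine is described by five numbers: this arity is known
  before the machine is, and the description can then be supplied as input.\<close>

datatype prog = Test nat | Add "nat set" "nat set" | Seq prog prog | Star prog

definition add_sub :: "nat set \<Rightarrow> nat set \<Rightarrow> nat \<Rightarrow> int" where
  "add_sub A B i = of_bool (i \<in> A) - of_bool (i \<in> B)"

primrec sem :: "prog \<Rightarrow> ((nat \<Rightarrow> int) \<times> (nat \<Rightarrow> int)) set" where
  "sem (Test r) = {(s, s'). s r = 0 \<and> s' = s}"
| "sem (Add A B) = {(s, s'). s' = (\<lambda>i. s i + add_sub A B i)}"
| "sem (Seq p q) = sem p O sem q"
| "sem (Star p) = (sem p)\<^sup>*"

abbreviation ints :: "(nat \<Rightarrow> nat) \<Rightarrow> nat \<Rightarrow> int" where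
  "ints \<sigma> \<equiv> \<lambda>i. int (\<sigma> i)"

text \<open>Registers may be negative during a run. Only completed runs from natural states have to
  end in natural states; this is what makes the relations compose.\<close>

definition implements :: "prog \<Rightarrow> ((nat \<Rightarrow> nat) \<Rightarrow> (nat \<Rightarrow> nat) \<Rightarrow> bool) \<Rightarrow> bool" where
  "implements p R \<longleftrightarrow> (\<forall>\<sigma> s. (ints \<sigma>, s) \<in> sem p \<longleftrightarrow> (\<exists>\<sigma>'. s = ints \<sigma>' \<and> R \<sigma> \<sigma>'))"

lemma ints_eq_iff [simp]: "ints \<sigma> = ints \<sigma>' \<longleftrightarrow> \<sigma> = \<sigma>'"
  by (auto simp: fun_eq_iff)

lemma implements_Seq: "implements p R \<Longrightarrow> implements q S \<Longrightarrow> implements (Seq p q) (R OO S)"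
  unfolding implements_def by (fastforce simp: relcomp_unfold)

lemma implements_Star:
  assumes "implements p R"
  shows "implements (Star p) R\<^sup>*\<^sup>*"
proof -
  have *: "(ints \<sigma>, s) \<in> sem p \<longleftrightarrow> (\<exists>\<sigma>'. s = ints \<sigma>' \<and> R \<sigma> \<sigma>')" for \<sigma> s
    using assms by (simp add: implements_def)
  have "\<exists>\<sigma>'. s = ints \<sigma>' \<and> R\<^sup>*\<^sup>* \<sigma> \<sigma>'" if "(ints \<sigma>, s) \<in> (sem p)\<^sup>*" for \<sigma> s
    using that
  proof (induction rule: rtrancl_induct)
    case (step y z)
    then show ?case using * by (metis rtranclp.rtrancl_into_rtrancl)
  qed auto
  moreover have "(ints \<sigma>, ints \<sigma>') \<in> (sem p)\<^sup>*" if "R\<^sup>*\<^sup>* \<sigma> \<sigma>'" for \<sigma> \<sigma>'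
    using that
  proof (induction rule: rtranclp_induct)
    case (step y z)
    then have "(ints y, ints z) \<in> sem p" using * by blast
    with step.IH show ?case by (rule rtrancl_into_rtrancl)
  qed simp
  ultimately show ?thesis unfolding implements_def by auto
qed

lemma sem_Star_Add:
  "(s, s') \<in> sem (Star (Add A B)) \<longleftrightarrow> (\<exists>n. s' = (\<lambda>i. s i + int n * add_sub A B i))"
proof
  assume "(s, s') \<in> sem (Star (Add A B))"
  then have "(s, s') \<in> (sem (Add A B))\<^sup>*" by simp
  then show "\<exists>n. s' = (\<lambda>i. s i + int n * add_sub A B i)"
  proof (induction rule: rtrancl_induct)
    case base
    show ?case by (rule exI[of _ 0]) simp
  next
    case (step y z)
    then obtain n where "y = (\<lambda>i. s i + int n * add_sub A B i)" by blast
    with step(2) have "z = (\<lambda>i. s i + int (Suc n) * add_sub A B i)"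
      by (auto simp: algebra_simps)
    then show ?case by blast
  qed
next
  have "(s, \<lambda>i. s i + int n * add_sub A B i) \<in> (sem (Add A B))\<^sup>*" for n
  proof (induction n)
    case (Suc n)
    have "(\<lambda>i. s i + int n * add_sub A B i, \<lambda>i. s i + int (Suc n) * add_sub A B i) \<in> sem (Add A B)"
      by (auto simp: algebra_simps)
    with Suc show ?case by (rule rtrancl_into_rtrancl)
  qed simp
  then show "\<exists>n. s' = (\<lambda>i. s i + int n * add_sub A B i) \<Longrightarrow> (s, s') \<in> sem (Star (Add A B))"
    by auto
qed

definition inc :: "nat \<Rightarrow> prog" where "inc r = Add {r} {}"

text \<open>The loop guesses how often to count down, and the test discards every wrong guess. A
  negative register could never pass, so starting from a natural state is essential.\<close>

definition clear :: "nat \<Rightarrow> prog" where "clear r = Seq (Star (Add {} {r})) (Test r)"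

definition guess :: "nat \<Rightarrow> prog" where "guess r = Seq (clear r) (Star (inc r))"

text \<open>Empties both registers into \<open>t\<close> in lockstep and restores them from there.\<close>

definition eq_test :: "nat \<Rightarrow> nat \<Rightarrow> nat \<Rightarrow> prog" where
  "eq_test a b t = Seq (clear t) (Seq (Star (Add {t} {a, b})) (Seq (Test a) (Seq (Test b)
    (Seq (Star (Add {a, b} {t})) (Test t)))))"

lemma implements_inc: "implements (inc r) (\<lambda>\<sigma> \<sigma>'. \<sigma>' = \<sigma>(r := Suc (\<sigma> r)))"
proof -
  have "(\<lambda>i. int (\<sigma> i) + add_sub {r} {} i) = ints (\<sigma>(r := Suc (\<sigma> r)))" for \<sigma>
    by (auto simp: add_sub_def)
  then show ?thesis unfolding implements_def inc_def by auto
qed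

lemma implements_clear: "implements (clear r) (\<lambda>\<sigma> \<sigma>'. \<sigma>' = \<sigma>(r := 0))"
proof -
  have "(ints \<sigma>, s) \<in> sem (clear r) \<longleftrightarrow> s = ints (\<sigma>(r := 0))" for \<sigma> s
  proof -
    have "(ints \<sigma>, s) \<in> sem (clear r) \<longleftrightarrow>
        (\<exists>n. s = (\<lambda>i. int (\<sigma> i) + int n * add_sub {} {r} i)) \<and> s r = 0"
      unfolding clear_def sem.simps(3) sem.simps(1) relcomp_unfold using sem_Star_Add[of "ints \<sigma>" _ "{}" "{r}"]
      by auto
    also have "\<dots> \<longleftrightarrow> s = (\<lambda>i. int (\<sigma> i) + int (\<sigma> r) * add_sub {} {r} i)"
      by (auto simp: add_sub_def fun_eq_iff)
    also have "\<dots> \<longleftrightarrow> s = ints (\<sigma>(r := 0))"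
      by (auto simp: add_sub_def fun_eq_iff)
    finally show ?thesis .
  qed
  then show ?thesis by (auto simp: implements_def)
qed

lemma implements_guess: "implements (guess r) (\<lambda>\<sigma> \<sigma>'. \<exists>n. \<sigma>' = \<sigma>(r := n))"
proof -
  have "implements (Star (inc r)) (\<lambda>\<sigma> \<sigma>'. \<exists>n. \<sigma>' = \<sigma>(r := \<sigma> r + n))"
  proof -
    have "(\<lambda>i. int (\<sigma> i) + int n * add_sub {r} {} i) = ints (\<sigma>(r := \<sigma> r + n))" for \<sigma> n
      by (auto simp: add_sub_def)
    then show ?thesis unfolding implements_def inc_def sem_Star_Add by (auto simp del: fun_upd_apply)
  qed
  from implements_Seq[OF implements_clear[of r] this] show ?thesis
    unfolding guess_def by (simp add: OO_def)
qed

lemma implements_eq_test: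
  assumes "a \<noteq> b" "a \<noteq> t" "b \<noteq> t"
  shows "implements (eq_test a b t) (\<lambda>\<sigma> \<sigma>'. \<sigma> a = \<sigma> b \<and> \<sigma>' = \<sigma>(t := 0))"
proof -
  let ?p = "Seq (Star (Add {t} {a, b})) (Seq (Test a) (Seq (Test b) (Seq (Star (Add {a, b} {t})) (Test t))))"
  have *: "(ints \<sigma>, s) \<in> sem ?p \<longleftrightarrow> \<sigma> a = \<sigma> b \<and> s = ints \<sigma>" if "\<sigma> t = 0" for \<sigma> s
  proof -
    have "(ints \<sigma>, s) \<in> sem ?p \<longleftrightarrow> (\<exists>n m. let s1 = (\<lambda>i. int (\<sigma> i) + int n * add_sub {t} {a, b} i) in
       s1 a = 0 \<and> s1 b = 0 \<and> s = (\<lambda>i. s1 i + int m * add_sub {a, b} {t} i) \<and> s t = 0)"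
      unfolding sem.simps(1,3) relcomp_unfold by (auto simp: sem_Star_Add Let_def simp del: sem.simps(4))
    also have "\<dots> \<longleftrightarrow> \<sigma> a = \<sigma> b \<and> s = ints \<sigma>" (is "?L \<longleftrightarrow> ?R")
    proof
      show "?L \<Longrightarrow> ?R"
        using assms that by (auto simp: Let_def add_sub_def fun_eq_iff)
      show "?R \<Longrightarrow> ?L"
        \<comment> \<open>Both loops run \<open>\<sigma> a\<close> times, first emptying the
          registers into \<open>t\<close> and then restoring them.\<close>
        using assms that by (auto simp: Let_def add_sub_def fun_eq_iff intro!: exI[of _ "\<sigma> a"])
    qed
    finally show ?thesis .
  qed
  have c: "(ints \<sigma>, s) \<in> sem (clear t) \<longleftrightarrow> s = ints (\<sigma>(t := 0))" for \<sigma> s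
    using implements_clear by (auto simp: implements_def)
  have "(ints \<sigma>, s) \<in> sem (eq_test a b t) \<longleftrightarrow> (ints (\<sigma>(t := 0)), s) \<in> sem ?p" for \<sigma> s
    unfolding eq_test_def sem.simps(3)[of "clear t"] relcomp_unfold by (auto simp: c)
  also have "\<dots> \<sigma> s \<longleftrightarrow> \<sigma> a = \<sigma> b \<and> s = ints (\<sigma>(t := 0))" for \<sigma> s
    using assms by (subst *) auto
  finally show ?thesis by (auto simp: implements_def)
qed

text \<open>The registers from \<open>n\<close> on are scratch space.\<close>

definition checked_by ::
  "nat \<Rightarrow> ((nat \<Rightarrow> nat) \<Rightarrow> bool) \<Rightarrow> ((nat \<Rightarrow> nat) \<Rightarrow> (nat \<Rightarrow> nat) \<Rightarrow> bool) \<Rightarrow> bool" where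
  "checked_by n \<Phi> R \<longleftrightarrow>
    (\<forall>\<sigma> \<sigma>'. R \<sigma> \<sigma>' \<longrightarrow> \<Phi> \<sigma>) \<and>
    (\<forall>\<sigma> \<sigma>'. \<forall>i<n. R \<sigma> \<sigma>' \<longrightarrow> \<sigma>' i = \<sigma> i) \<and>
    (\<forall>\<sigma>. \<Phi> \<sigma> \<longrightarrow> (\<exists>\<sigma>'. R \<sigma> \<sigma>')) \<and>
    (\<forall>\<sigma> \<sigma>'. (\<forall>i<n. \<sigma> i = \<sigma>' i) \<longrightarrow> \<Phi> \<sigma> \<longrightarrow> \<Phi> \<sigma>')"

lemma checked_byD:
  assumes "checked_by n \<Phi> R"
  shows "R \<sigma> \<sigma>' \<Longrightarrow> \<Phi> \<sigma>" "R \<sigma> \<sigma>' \<Longrightarrow> i < n \<Longrightarrow> \<sigma>' i = \<sigma> i"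
    "\<Phi> \<sigma> \<Longrightarrow> \<exists>\<sigma>'. R \<sigma> \<sigma>'" "\<forall>i<n. \<sigma> i = \<sigma>' i \<Longrightarrow> \<Phi> \<sigma> \<Longrightarrow> \<Phi> \<sigma>'"
  using assms unfolding checked_by_def by blast+

text \<open>Negation is not among the operations available for such predicates: a program can
  confirm \<open>\<Phi>\<close> by completing, but the absence of a completed run cannot be observed
  from within a program.\<close>

definition checks :: "nat \<Rightarrow> ((nat \<Rightarrow> nat) \<Rightarrow> bool) \<Rightarrow> bool" where
  "checks n \<Phi> \<longleftrightarrow> (\<exists>p R. implements p R \<and> checked_by n \<Phi> R)"

lemma checksI:
  assumes "\<And>\<sigma> \<sigma>'. \<forall>i<n. \<sigma> i = \<sigma>' i \<Longrightarrow> \<Phi> \<sigma> \<Longrightarrow> \<Phi> \<sigma>'"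
    and "implements p R"
    and "\<And>\<sigma> \<sigma>'. R \<sigma> \<sigma>' \<Longrightarrow> \<Phi> \<sigma> \<and> (\<forall>i<n. \<sigma>' i = \<sigma> i)"
    and "\<And>\<sigma>. \<Phi> \<sigma> \<Longrightarrow> \<exists>\<sigma>'. R \<sigma> \<sigma>'"
  shows "checks n \<Phi>"
proof -
  have "checked_by n \<Phi> R"
    unfolding checked_by_def using assms by blast
  with assms(2) show ?thesis by (auto simp: checks_def)
qed

section \<open>Closure properties of checkable predicates\<close>

lemma checks_eq:
  assumes "a < n" "b < n"
  shows "checks n (\<lambda>\<sigma>. \<sigma> a = \<sigma> b)"
proof (cases "a = b")
  case True
  \<comment> \<open>\<open>eq_test\<close> presupposes distinct registers. Here the predicate is
    always true, and clearing the scratch register \<open>n\<close> serves as a program without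
    visible effect.\<close>
  then show ?thesis using assms by (intro checksI[OF _ implements_clear[of n]]) auto
next
  case False
  with assms have "implements (eq_test a b n) (\<lambda>\<sigma> \<sigma>'. \<sigma> a = \<sigma> b \<and> \<sigma>' = \<sigma>(n := 0))"
    by (intro implements_eq_test) auto
  then show ?thesis by (rule checksI[rotated]) (use assms in auto)
qed

lemma checks_zero:
  assumes "a < n"
  shows "checks n (\<lambda>\<sigma>. \<sigma> a = 0)"
proof -
  have "implements (Test a) (\<lambda>\<sigma> \<sigma>'. \<sigma> a = 0 \<and> \<sigma>' = \<sigma>)"
    by (auto simp: implements_def)
  then show ?thesis by (rule checksI[rotated]) (use assms in auto)
qed

lemma checks_conj:
  assumes "checks n \<Phi>" "checks n \<Psi>"
  shows "checks n (\<lambda>\<sigma>. \<Phi> \<sigma> \<and> \<Psi> \<sigma>)"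
proof -
  obtain p R where p0: "implements p R" "checked_by n \<Phi> R"
    using assms(1) by (auto simp: checks_def)
  note p = p0(1) checked_byD[OF p0(2)]
  obtain q S where q0: "implements q S" "checked_by n \<Psi> S"
    using assms(2) by (auto simp: checks_def)
  note q = q0(1) checked_byD[OF q0(2)]
  show ?thesis
  proof (rule checksI[OF _ implements_Seq[OF p(1) q(1)]])
    show "(\<Phi> \<sigma> \<and> \<Psi> \<sigma>) \<and> (\<forall>i<n. \<sigma>' i = \<sigma> i)" if "(R OO S) \<sigma> \<sigma>'" for \<sigma> \<sigma>'
    proof -
      from that obtain \<tau> where \<tau>: "R \<sigma> \<tau>" "S \<tau> \<sigma>'" by auto
      then have "\<forall>i<n. \<tau> i = \<sigma> i" "\<Phi> \<sigma>" "\<Psi> \<tau>" "\<forall>i<n. \<sigma>' i = \<tau> i"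
        using p(2,3) q(2,3) by blast+
      then show ?thesis using q(5)[of \<tau> \<sigma>] by auto
    qed
    show "\<exists>\<sigma>'. (R OO S) \<sigma> \<sigma>'" if "\<Phi> \<sigma> \<and> \<Psi> \<sigma>" for \<sigma>
    proof -
      from that obtain \<tau> where \<tau>: "R \<sigma> \<tau>" using p(4) by blast
      then have "\<forall>i<n. \<sigma> i = \<tau> i" using p(3) by force
      then have "\<Psi> \<tau>" using q(5) that by blast
      then show ?thesis using \<tau> q(4) by blast
    qed
  qed (use p(5) q(5) in blast)
qed

text \<open>Nondeterminism plays the existential quantifier: the first scratch register is guessed
  and from then on treated as an input. Wrong guesses have no completed runs.\<close>

lemma checks_ex:
  assumes "checks (Suc n) \<Phi>"
  shows "checks n (\<lambda>\<sigma>. \<exists>x. \<Phi> (\<sigma>(n := x)))"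
proof -
  obtain p R where p0: "implements p R" "checked_by (Suc n) \<Phi> R"
    using assms by (auto simp: checks_def)
  note p = p0(1) checked_byD[OF p0(2)]
  show ?thesis
  proof (rule checksI[OF _ implements_Seq[OF implements_guess[of n] p(1)]])
    fix \<sigma> \<sigma>' :: "nat \<Rightarrow> nat"
    assume *: "\<forall>i<n. \<sigma> i = \<sigma>' i" and "\<exists>x. \<Phi> (\<sigma>(n := x))"
    then obtain x where "\<Phi> (\<sigma>(n := x))" by blast
    moreover have "\<forall>i<Suc n. (\<sigma>(n := x)) i = (\<sigma>'(n := x)) i" using * by auto
    ultimately show "\<exists>x. \<Phi> (\<sigma>'(n := x))" using p(5) by blast
  next
    fix \<sigma> \<sigma>' :: "nat \<Rightarrow> nat"
    assume "((\<lambda>\<sigma> \<sigma>'. \<exists>x. \<sigma>' = \<sigma>(n := x)) OO R) \<sigma> \<sigma>'"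
    then obtain x where x: "R (\<sigma>(n := x)) \<sigma>'" by auto
    have "\<forall>i<n. \<sigma>' i = \<sigma> i"
      using p(3)[OF x] by auto
    with p(2)[OF x] show "(\<exists>x. \<Phi> (\<sigma>(n := x))) \<and> (\<forall>i<n. \<sigma>' i = \<sigma> i)" by blast
  next
    fix \<sigma> assume "\<exists>x. \<Phi> (\<sigma>(n := x))"
    then show "\<exists>\<sigma>'. ((\<lambda>\<sigma> \<sigma>'. \<exists>x. \<sigma>' = \<sigma>(n := x)) OO R) \<sigma> \<sigma>'" using p(4) by blast
  qed
qed

text \<open>Inputs have to survive, so the increment is applied to a guessed and verified copy of
  \<open>\<sigma> b\<close> in register \<open>n\<close>.\<close>

lemma checks_Suc:
  assumes "a < n" "b < n"
  shows "checks n (\<lambda>\<sigma>. \<sigma> a = Suc (\<sigma> b))"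
proof -
  have "checks n (\<lambda>\<sigma>. \<sigma> b = \<sigma> b \<and> \<sigma> a = Suc (\<sigma> b))"
  proof -
    have i: "implements (Seq (guess n) (Seq (eq_test b n (Suc n)) (Seq (inc n) (eq_test a n (Suc n)))))
      ((\<lambda>\<sigma> \<sigma>'. \<exists>x. \<sigma>' = \<sigma>(n := x)) OO ((\<lambda>\<sigma> \<sigma>'. \<sigma> b = \<sigma> n \<and> \<sigma>' = \<sigma>(Suc n := 0)) OO
       ((\<lambda>\<sigma> \<sigma>'. \<sigma>' = \<sigma>(n := Suc (\<sigma> n))) OO (\<lambda>\<sigma> \<sigma>'. \<sigma> a = \<sigma> n \<and> \<sigma>' = \<sigma>(Suc n := 0)))))"
      using assms
      by (intro implements_Seq implements_guess implements_eq_test implements_inc) auto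
    show ?thesis
      by (rule checksI[OF _ i]) (use assms in \<open>auto simp: OO_def\<close>)
  qed
  then show ?thesis by simp
qed

text \<open>For terms applied to tuples of an unsuitable length, where \<open>rec_eval\<close>
  yields no value.\<close>

lemma checks_False: "checks n (\<lambda>\<sigma>. False)"
proof -
  have "checks (Suc n) (\<lambda>\<sigma>. \<sigma> n = Suc (\<sigma> n))" by (rule checks_Suc) auto
  from checks_ex[OF this] show ?thesis by simp
qed

text \<open>This is the graph of primitive recursion with a step relation in place of a step
  function. If \<open>S\<close> ignores the values, it becomes a bounded universal quantifier over
  the step index, which is how minimisation uses it.\<close>

primrec chain :: "(nat \<Rightarrow> nat \<Rightarrow> nat \<Rightarrow> bool) \<Rightarrow> nat \<Rightarrow> nat \<Rightarrow> nat \<Rightarrow> bool" where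
  "chain S x 0 y \<longleftrightarrow> y = x"
| "chain S x (Suc k) y \<longleftrightarrow> (\<exists>z. chain S x k z \<and> S k z y)"

lemma checks_chain:
  assumes abc: "a < n" "b < n" "c < n"
    and "checks (n + 3) \<Phi>"
  shows "checks n (\<lambda>\<sigma>. chain (\<lambda>i r r'. \<Phi> (\<sigma>(n := i, n + 1 := r, n + 2 := r'))) (\<sigma> a) (\<sigma> c) (\<sigma> b))"
proof -
  obtain p R where p0: "implements p R" "checked_by (n + 3) \<Phi> R"
    using assms(4) by (auto simp: checks_def)
  note p = p0(1) checked_byD[OF p0(2)]
  let ?S = "\<lambda>\<sigma> i r r'. \<Phi> (\<sigma>(n := i, n + 1 := r, n + 2 := r'))"
  have S_cong: "?S \<sigma> = ?S \<sigma>'" if "\<forall>i<n. \<sigma> i = \<sigma>' i" for \<sigma> \<sigma>'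
  proof -
    have "?S \<sigma> i r r' \<longleftrightarrow> ?S \<sigma>' i r r'" for i r r'
    proof -
      have "(\<sigma>(n := i, n + 1 := r, n + 2 := r')) j = (\<sigma>'(n := i, n + 1 := r, n + 2 := r')) j" if "j < n + 3" for j
      proof -
        from that consider "j < n" | "j = n" | "j = n + 1" | "j = n + 2" by linarith
        then show ?thesis using \<open>\<forall>i<n. \<sigma> i = \<sigma>' i\<close> by cases auto
      qed
      then show ?thesis using p(5) by metis
    qed
    then show ?thesis by (simp add: fun_eq_iff)
  qed
  let ?G = "\<lambda>r \<sigma> \<sigma>'. \<exists>x. \<sigma>' = \<sigma>(r := x)"
  let ?E = "\<lambda>r r' \<sigma> \<sigma>'. \<sigma> r = \<sigma> r' \<and> \<sigma>' = \<sigma>(n + 3 := (0::nat))"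
  \<comment> \<open>Register \<open>n\<close> is the step index, \<open>n + 1\<close> the current
    value, \<open>n + 2\<close> the guessed next value and \<open>n + 3\<close> scratch space.
    Copying \<open>n + 2\<close> to \<open>n + 1\<close> is done by a guess and an equality
    test.\<close>
  define B where "B = ?G (n + 2) OO (R OO (?G (n + 1) OO (?E (n + 1) (n + 2) OO (\<lambda>\<sigma> \<sigma>'. \<sigma>' = \<sigma>(n := Suc (\<sigma> n))))))"
  define body where "body = Seq (guess (n + 2)) (Seq p (Seq (guess (n + 1)) (Seq (eq_test (n + 1) (n + 2) (n + 3)) (inc n))))"
  have body: "implements body B"
    unfolding body_def B_def by (intro implements_Seq implements_guess p(1) implements_eq_test implements_inc) auto
  have B_sound: "?S \<sigma> (\<sigma> n) (\<sigma> (n + 1)) (\<sigma>' (n + 1)) \<and> \<sigma>' n = Suc (\<sigma> n) \<and> (\<forall>i<n. \<sigma>' i = \<sigma> i)"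
    if "B \<sigma> \<sigma>'" for \<sigma> \<sigma>'
  proof -
    from that obtain x \<tau> where \<tau>: "R (\<sigma>(n + 2 := x)) \<tau>" and
      \<sigma>': "\<sigma>' = \<tau>(n + 1 := \<tau> (n + 2), n + 3 := 0, n := Suc (\<tau> n))"
      by (auto simp: B_def OO_def)
    have 1: "\<tau> i = (\<sigma>(n + 2 := x)) i" if "i < n + 3" for i using p(3)[OF \<tau>] that by blast
    have "\<sigma>(n + 2 := x) = \<sigma>(n := \<sigma> n, n + 1 := \<sigma> (n + 1), n + 2 := x)" by auto
    with p(2)[OF \<tau>] show ?thesis using 1 by (auto simp: \<sigma>')
  qed
  have B_complete: "\<exists>\<sigma>'. B \<sigma> \<sigma>' \<and> \<sigma>' (n + 1) = x" if "?S \<sigma> (\<sigma> n) (\<sigma> (n + 1)) x" for \<sigma> x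
  proof -
    have "\<sigma>(n + 2 := x) = \<sigma>(n := \<sigma> n, n + 1 := \<sigma> (n + 1), n + 2 := x)" by auto
    with that have "\<Phi> (\<sigma>(n + 2 := x))" by simp
    then obtain \<tau> where \<tau>: "R (\<sigma>(n + 2 := x)) \<tau>" using p(4) by blast
    have "\<tau> (n + 2) = x" using p(3)[OF \<tau>, of "n + 2"] by simp
    have "B \<sigma> (\<tau>(n + 1 := x, n + 3 := 0, n := Suc (\<tau> n)))"
      unfolding B_def
      by (rule relcomppI[where b = "\<sigma>(n + 2 := x)"], rule exI, rule refl, rule relcomppI[where b = \<tau>], rule \<tau>,
          rule relcomppI[where b = "\<tau>(n + 1 := x)"], rule exI, rule refl, rule relcomppI[where b = "\<tau>(n + 1 := x, n + 3 := 0)"])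
        (use \<open>\<tau> (n + 2) = x\<close> in auto)
    then show ?thesis by (intro exI[of _ "\<tau>(n + 1 := x, n + 3 := 0, n := Suc (\<tau> n))"]) simp
  qed
  have star_sound: "chain (?S \<sigma>) (\<sigma> (n + 1)) (\<sigma>' n) (\<sigma>' (n + 1)) \<and> (\<forall>i<n. \<sigma>' i = \<sigma> i)"
    if "B\<^sup>*\<^sup>* \<sigma> \<sigma>'" "\<sigma> n = 0" for \<sigma> \<sigma>'
    using that
  proof (induction rule: rtranclp_induct)
    case (step y z)
    have IH: "chain (?S \<sigma>) (\<sigma> (n + 1)) (y n) (y (n + 1))" "\<forall>i<n. y i = \<sigma> i"
      using step by blast+
    then have "?S y = ?S \<sigma>" by (intro S_cong) auto
    then have "?S \<sigma> (y n) (y (n + 1)) (z (n + 1))" and z: "z n = Suc (y n)" "\<forall>i<n. z i = y i"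
      using B_sound[OF step(2)] by metis+
    with IH(1) have "chain (?S \<sigma>) (\<sigma> (n + 1)) (z n) (z (n + 1))"
      unfolding z(1) chain.simps by blast
    then show ?case using z(2) IH(2) by metis
  qed simp
  have star_complete: "\<exists>\<sigma>'. B\<^sup>*\<^sup>* \<sigma> \<sigma>' \<and> \<sigma>' n = k \<and> \<sigma>' (n + 1) = y \<and> (\<forall>i<n. \<sigma>' i = \<sigma> i)"
    if "chain (?S \<sigma>) (\<sigma> (n + 1)) k y" "\<sigma> n = 0" for \<sigma> k y
    using that
  proof (induction k arbitrary: y)
    case 0
    then show ?case by auto
  next
    case (Suc k)
    then obtain z where z: "chain (?S \<sigma>) (\<sigma> (n + 1)) k z" "?S \<sigma> k z y"
      unfolding chain.simps by blast
    then obtain \<tau> where \<tau>: "B\<^sup>*\<^sup>* \<sigma> \<tau>" "\<tau> n = k" "\<tau> (n + 1) = z" "\<forall>i<n. \<tau> i = \<sigma> i"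
      using Suc by blast
    then have "?S \<sigma> = ?S \<tau>" by (intro S_cong) auto
    with z(2) have "?S \<tau> (\<tau> n) (\<tau> (n + 1)) y" unfolding \<tau>(2,3) by metis
    from B_complete[OF this] obtain \<sigma>' where \<sigma>': "B \<tau> \<sigma>'" "\<sigma>' (n + 1) = y" by blast
    moreover have "\<sigma>' n = Suc k" "\<forall>i<n. \<sigma>' i = \<sigma> i"
      using B_sound[OF \<sigma>'(1)] \<tau> by auto
    moreover have "B\<^sup>*\<^sup>* \<sigma> \<sigma>'"
      using rtranclp.rtrancl_into_rtrancl[of B, OF \<tau>(1) \<sigma>'(1)] .
    ultimately show ?case by (intro exI[of _ \<sigma>'] conjI)
  qed
  \<comment> \<open>The loop may be left at any time; the last two tests retain only the runs that
    stop after \<open>\<sigma> c\<close> steps with the value \<open>\<sigma> b\<close>.\<close>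
  let ?Q = "(\<lambda>\<sigma> \<sigma>'. \<sigma>' = \<sigma>(n := 0)) OO (?G (n + 1) OO (?E (n + 1) a OO (B\<^sup>*\<^sup>* OO (?E n c OO ?E (n + 1) b))))"
  have impl: "implements (Seq (clear n) (Seq (guess (n + 1)) (Seq (eq_test (n + 1) a (n + 3)) (Seq (Star body)
    (Seq (eq_test n c (n + 3)) (eq_test (n + 1) b (n + 3))))))) ?Q"
    using abc by (intro implements_Seq implements_guess implements_eq_test implements_clear implements_Star body) auto
  let ?init = "\<lambda>\<sigma>. \<sigma>(n := 0, n + 1 := \<sigma> a, n + 3 := 0)"
  have Q: "?Q \<sigma> \<sigma>' \<longleftrightarrow> (\<exists>\<tau>. B\<^sup>*\<^sup>* (?init \<sigma>) \<tau> \<and> \<tau> n = \<tau> c \<and> \<tau> (n + 1) = \<tau> b \<and> \<sigma>' = \<tau>(n + 3 := 0))" for \<sigma> \<sigma>'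
    using abc by (auto simp: OO_def)
  have S_init: "?S (?init \<sigma>) = ?S \<sigma>" for \<sigma> by (intro S_cong) auto
  show ?thesis
  proof (rule checksI[OF _ impl])
    fix \<sigma> \<sigma>' :: "nat \<Rightarrow> nat"
    assume eq: "\<forall>i<n. \<sigma> i = \<sigma>' i"
    from S_cong[OF eq] eq abc show "chain (?S \<sigma>) (\<sigma> a) (\<sigma> c) (\<sigma> b) \<Longrightarrow> chain (?S \<sigma>') (\<sigma>' a) (\<sigma>' c) (\<sigma>' b)"
      by auto
  next
    fix \<sigma> \<sigma>' :: "nat \<Rightarrow> nat"
    assume "?Q \<sigma> \<sigma>'"
    then obtain \<tau> where *: "B\<^sup>*\<^sup>* (?init \<sigma>) \<tau>" "\<tau> n = \<tau> c" "\<tau> (n + 1) = \<tau> b" "\<sigma>' = \<tau>(n + 3 := 0)"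
      unfolding Q by blast
    have "chain (?S \<sigma>) (\<sigma> a) (\<tau> n) (\<tau> (n + 1)) \<and> (\<forall>i<n. \<tau> i = \<sigma> i)"
      using star_sound[OF *(1)] unfolding S_init by auto
    with * abc show "chain (?S \<sigma>) (\<sigma> a) (\<sigma> c) (\<sigma> b) \<and> (\<forall>i<n. \<sigma>' i = \<sigma> i)"
      by auto
  next
    fix \<sigma> assume "chain (?S \<sigma>) (\<sigma> a) (\<sigma> c) (\<sigma> b)"
    then have "chain (?S (?init \<sigma>)) (?init \<sigma> (n + 1)) (\<sigma> c) (\<sigma> b)"
      unfolding S_init by simp
    from star_complete[OF this] obtain \<tau>
      where *: "B\<^sup>*\<^sup>* (?init \<sigma>) \<tau>" "\<tau> n = \<sigma> c" "\<tau> (n + 1) = \<sigma> b" "\<forall>i<n. \<tau> i = ?init \<sigma> i"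
      by auto
    then have "\<tau> n = \<tau> c" "\<tau> (n + 1) = \<tau> b" using abc by auto
    with *(1) show "\<exists>\<sigma>'. ?Q \<sigma> \<sigma>'" unfolding Q by blast
  qed
qed

section \<open>Checking the graphs of partial recursive functions\<close>

text \<open>Since failure cannot be tested, every clause of \<open>rec_eval\<close> is rephrased by
  conjunctions, existential quantifiers and chains. Intermediate results are placed in registers
  from \<open>n\<close> on, so the induction has to range over all \<open>n\<close>,
  \<open>rs\<close> and \<open>out\<close>.\<close>

lemma checks_rec_eval:
  assumes "\<forall>r\<in>set rs. r < n" "out < n"
  shows "checks n (\<lambda>\<sigma>. rec_eval f (map \<sigma> rs) (\<sigma> out))"
  using assms
proof (induction f arbitrary: rs out n)
  case Zero
  have "rec_eval Zero xs y \<longleftrightarrow> y = 0" for xs y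
    by (auto intro: rec_eval.intros elim: rec_eval.cases)
  then show ?case using checks_zero[OF Zero(2)] by simp
next
  case Succ
  show ?case
  proof (cases "\<exists>r. rs = [r]")
    case True
    then obtain r where r: "rs = [r]" by blast
    have "rec_eval Succ [x] y \<longleftrightarrow> y = Suc x" for x y
      by (auto intro: rec_eval.intros elim: rec_eval.cases)
    then show ?thesis using checks_Suc[of out n r] Succ by (simp add: r)
  next
    case False
    then have "\<not> rec_eval Succ (map \<sigma> rs) y" for \<sigma> :: "nat \<Rightarrow> nat" and y
      by (auto elim!: rec_eval.cases[of Succ] simp: map_eq_Cons_conv)
    then show ?thesis using checks_False by simp
  qed
next
  case (Proj i)
  have "rec_eval (Proj i) xs y \<longleftrightarrow> i < length xs \<and> y = xs ! i" for xs y
    by (auto intro: rec_eval.intros elim: rec_eval.cases)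
  then show ?case using checks_eq[of out n "rs ! i"] checks_False Proj
    by (cases "i < length rs") auto
next
  case (Comp f gs)
  \<comment> \<open>Induction over the inner functions \<open>gs'\<close> still to be evaluated. The
    registers \<open>bs\<close> hold the arguments of \<open>f\<close> found so far; each evaluation
    binds one more register \<open>n\<close> and appends it to \<open>bs\<close>.\<close>
  have "checks n (\<lambda>\<sigma>. \<exists>ys. list_all2 (rec_eval' (map \<sigma> rs)) gs' ys \<and> rec_eval f (map \<sigma> bs @ ys) (\<sigma> out))"
    if "set gs' \<subseteq> set gs" "\<forall>r\<in>set rs \<union> set bs. r < n" "out < n" 
       and rec_eval': "rec_eval' = (\<lambda>xs g y. rec_eval g xs y)" for gs' bs n rec_eval'
    using that(1-3)
  proof (induction gs' arbitrary: bs n)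
    case Nil
    then show ?case using Comp.IH(1)[of bs n out] by auto
  next
    case (Cons g gs')
    have "checks (Suc n) (\<lambda>\<sigma>. rec_eval g (map \<sigma> rs) (\<sigma> n))"
      using Cons.prems by (intro Comp.IH(2)) (auto intro: less_SucI)
    moreover have "checks (Suc n) (\<lambda>\<sigma>. \<exists>ys. list_all2 (rec_eval' (map \<sigma> rs)) gs' ys \<and>
        rec_eval f (map \<sigma> (bs @ [n]) @ ys) (\<sigma> out))"
      using Cons.prems by (intro Cons.IH) (auto intro: less_SucI)
    ultimately have "checks n (\<lambda>\<sigma>. \<exists>x. rec_eval g (map (\<sigma>(n := x)) rs) ((\<sigma>(n := x)) n) \<and>
       (\<exists>ys. list_all2 (rec_eval' (map (\<sigma>(n := x)) rs)) gs' ys \<and>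
        rec_eval f (map (\<sigma>(n := x)) (bs @ [n]) @ ys) ((\<sigma>(n := x)) out)))"
      by (intro checks_ex checks_conj)
    also have "(\<lambda>\<sigma>. \<exists>x. rec_eval g (map (\<sigma>(n := x)) rs) ((\<sigma>(n := x)) n) \<and>
       (\<exists>ys. list_all2 (rec_eval' (map (\<sigma>(n := x)) rs)) gs' ys \<and>
        rec_eval f (map (\<sigma>(n := x)) (bs @ [n]) @ ys) ((\<sigma>(n := x)) out))) =
      (\<lambda>\<sigma>. \<exists>ys. list_all2 (rec_eval' (map \<sigma> rs)) (g # gs') ys \<and> rec_eval f (map \<sigma> bs @ ys) (\<sigma> out))"
    proof (rule ext)
      fix \<sigma> :: "nat \<Rightarrow> nat"
      have *: "map (\<sigma>(n := x)) rs = map \<sigma> rs" "map (\<sigma>(n := x)) bs = map \<sigma> bs" "(\<sigma>(n := x)) out = \<sigma> out" for x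
        using Cons.prems by auto
      show "(\<exists>x. rec_eval g (map (\<sigma>(n := x)) rs) ((\<sigma>(n := x)) n) \<and>
       (\<exists>ys. list_all2 (rec_eval' (map (\<sigma>(n := x)) rs)) gs' ys \<and>
        rec_eval f (map (\<sigma>(n := x)) (bs @ [n]) @ ys) ((\<sigma>(n := x)) out))) \<longleftrightarrow>
       (\<exists>ys. list_all2 (rec_eval' (map \<sigma> rs)) (g # gs') ys \<and> rec_eval f (map \<sigma> bs @ ys) (\<sigma> out))"
        unfolding * map_append by (auto simp: list_all2_Cons1 rec_eval')
    qed
    finally show ?case .
  qed
  from this[of gs "[]", OF _ _ _ refl]
  have "checks n (\<lambda>\<sigma>. \<exists>ys. list_all2 (\<lambda>g y. rec_eval g (map \<sigma> rs) y) gs ys \<and> rec_eval f ys (\<sigma> out))"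
    using Comp.prems by simp
  moreover have "rec_eval (Comp f gs) xs y \<longleftrightarrow> (\<exists>ys. list_all2 (\<lambda>g y. rec_eval g xs y) gs ys \<and> rec_eval f ys y)" for xs y
    by (auto intro: rec_eval.intros elim: rec_eval.cases)
  ultimately show ?case by simp
next
  case (PrimRec f g)
  show ?case
  proof (cases rs)
    case Nil
    have "\<not> rec_eval (PrimRec f g) [] y" for y by (auto elim: rec_eval.cases)
    then show ?thesis using Nil checks_False by simp
  next
    case (Cons c rs')
    let ?S = "\<lambda>xs i r r'. rec_eval g (i # r # xs) r'"
    have iff: "rec_eval (PrimRec f g) (k # xs) y \<longleftrightarrow> (\<exists>x. rec_eval f xs x \<and> chain (?S xs) x k y)" for k xs y
    proof (induction k arbitrary: y)
      case 0
      show ?case by (auto intro: rec_eval.intros elim: rec_eval.cases)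
    next
      case (Suc k)
      have "rec_eval (PrimRec f g) (Suc k # xs) y \<longleftrightarrow>
          (\<exists>r. rec_eval (PrimRec f g) (k # xs) r \<and> rec_eval g (k # r # xs) y)"
        by (auto intro: rec_eval.intros elim: rec_eval.cases)
      then show ?case by (auto simp: Suc.IH)
    qed
    \<comment> \<open>Register \<open>n\<close> holds the start value of the recursion; the next
      three hold the index, the old value and the new value of a chain step.\<close>
    have 1: "checks (Suc n) (\<lambda>\<sigma>. rec_eval f (map \<sigma> rs') (\<sigma> n))"
      using PrimRec.prems Cons by (intro PrimRec.IH) auto
    have 2: "checks (Suc n + 3) (\<lambda>\<sigma>. rec_eval g (map \<sigma> (Suc n # (Suc n + 1) # rs')) (\<sigma> (Suc n + 2)))"
      using PrimRec.prems Cons by (intro PrimRec.IH) auto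
    have "checks n (\<lambda>\<sigma>. \<exists>x. rec_eval f (map (\<sigma>(n := x)) rs') ((\<sigma>(n := x)) n) \<and>
      chain (\<lambda>i r r'. rec_eval g (map ((\<sigma>(n := x))(Suc n := i, Suc n + 1 := r, Suc n + 2 := r')) (Suc n # (Suc n + 1) # rs'))
         (((\<sigma>(n := x))(Suc n := i, Suc n + 1 := r, Suc n + 2 := r')) (Suc n + 2)))
        ((\<sigma>(n := x)) n) ((\<sigma>(n := x)) c) ((\<sigma>(n := x)) out))"
      using PrimRec.prems Cons by (intro checks_ex[OF checks_conj[OF 1 checks_chain[OF _ _ _ 2]]]) auto
    moreover have "c < n" "out < n" using PrimRec.prems Cons by auto
    moreover have "map (\<sigma>(n := x, Suc n := i, Suc (Suc n) := r, Suc (Suc (Suc n)) := r')) rs' = map \<sigma> rs'"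
      "map (\<sigma>(n := x)) rs' = map \<sigma> rs'" for \<sigma> :: "nat \<Rightarrow> nat" and x i r r'
      using PrimRec.prems Cons by auto
    note eq = this
    ultimately show ?thesis by (simp add: Cons iff eq)
  qed
next
  case (Mu f)
  \<comment> \<open>The condition on all smaller arguments becomes a chain that ignores its values.
    Being positive is expressed as being a successor, which is checkable.\<close>
  have iff: "rec_eval (Mu f) xs y \<longleftrightarrow> rec_eval f (y # xs) 0 \<and>
      (\<exists>z. chain (\<lambda>i _ _. \<exists>m. rec_eval f (i # xs) (Suc m)) z y z)" for xs y
  proof -
    have "rec_eval (Mu f) xs y \<longleftrightarrow> rec_eval f (y # xs) 0 \<and> (\<forall>i<y. \<exists>m. rec_eval f (i # xs) (Suc m))"
      by (auto intro!: rec_eval.intros elim!: rec_eval.cases[of "Mu f"] simp: gr0_conv_Suc) blast+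
    moreover have "chain (\<lambda>i _ _. Q i) z k w \<longleftrightarrow> (\<forall>i<k. Q i) \<and> (k = 0 \<longrightarrow> w = z)" for Q z k w
      by (induction k arbitrary: w) (auto simp: less_Suc_eq)
    ultimately show ?thesis by auto
  qed
  have 1: "checks (Suc n) (\<lambda>\<sigma>. rec_eval f (map \<sigma> (out # rs)) (\<sigma> n) \<and> \<sigma> n = 0)"
    using Mu.prems by (intro checks_conj Mu.IH checks_zero) auto
  have "checks (Suc (Suc (n + 3))) (\<lambda>\<sigma>. rec_eval f (map \<sigma> (n # rs)) (\<sigma> (n + 4)) \<and> \<sigma> (n + 4) = Suc (\<sigma> (n + 3)))"
    using Mu.prems by (intro checks_conj Mu.IH checks_Suc) auto
  from checks_ex[OF checks_ex[OF this]] have 2: "checks (n + 3) (\<lambda>\<sigma>. \<exists>m x. rec_eval f (map (\<sigma>(n + 3 := m, n + 4 := x)) (n # rs)) x \<and> x = Suc m)"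
    by (simp add: numeral_eq_Suc)
  \<comment> \<open>For such a chain the start and end values matter only at length 0, where they
    must agree. Register \<open>out\<close> can therefore supply the start, the length and the end
    at once.\<close>
  have "checks n (\<lambda>\<sigma>. (\<exists>x. rec_eval f (map (\<sigma>(n := x)) (out # rs)) x \<and> x = 0) \<and>
     chain (\<lambda>i r r'. \<exists>m x. rec_eval f (map ((\<sigma>(n := i, n + 1 := r, n + 2 := r'))(n + 3 := m, n + 4 := x)) (n # rs)) x \<and> x = Suc m)
       (\<sigma> out) (\<sigma> out) (\<sigma> out))"
    using checks_ex[OF 1] Mu.prems by (intro checks_conj checks_chain 2) auto
  moreover have "out \<noteq> n" using Mu.prems by auto
  moreover have "(\<exists>z. chain (\<lambda>i _ _. Q i) z k z) \<longleftrightarrow> chain (\<lambda>i _ _. Q i) k k k" for Q k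
  proof -
    have "chain (\<lambda>i _ _. Q i) z k w \<longleftrightarrow> (\<forall>i<k. Q i) \<and> (k = 0 \<longrightarrow> w = z)" for z k w
      by (induction k arbitrary: w) (auto simp: less_Suc_eq)
    then show ?thesis by auto
  qed
  moreover have "map (\<sigma>(n := x)) rs = map \<sigma> rs"
    "map (\<sigma>(n := i, Suc n := r, Suc (Suc n) := r', n + 3 := m, n + 4 := x)) rs = map \<sigma> rs"
    for \<sigma> :: "nat \<Rightarrow> nat" and i r r' m x
    using Mu.prems by auto
  note eq = this
  ultimately show ?case by (simp add: iff eq)
qed

text \<open>Guessing the output in register \<open>k\<close> turns a check of the graph into a test
  of definedness.\<close>

theorem rec_eval_program:
  "\<exists>p. \<forall>\<sigma>. (\<exists>s. (ints \<sigma>, s) \<in> sem p) \<longleftrightarrow> (\<exists>y. rec_eval f (map \<sigma> [0..<k]) y)"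
proof -
  have "checks (Suc k) (\<lambda>\<sigma>. rec_eval f (map \<sigma> [0..<k]) (\<sigma> k))"
    by (rule checks_rec_eval) auto
  from checks_ex[OF this] obtain p R where p: "implements p R"
    "checked_by k (\<lambda>\<sigma>. \<exists>x. rec_eval f (map (\<sigma>(k := x)) [0..<k]) ((\<sigma>(k := x)) k)) R"
    by (auto simp: checks_def)
  have "map (\<sigma>(k := x)) [0..<k] = map \<sigma> [0..<k]" for \<sigma> :: "nat \<Rightarrow> nat" and x by auto
  then have "(\<exists>\<sigma>'. R \<sigma> \<sigma>') \<longleftrightarrow> (\<exists>y. rec_eval f (map \<sigma> [0..<k]) y)" for \<sigma>
    using checked_byD(1,3)[OF p(2)] by (metis fun_upd_same)
  with p(1) show ?thesis unfolding implements_def by metis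
qed

section \<open>Counter machines\<close>

text \<open>
  Program points are continuations, i.e. the lists of programs that remain to be executed.
  A transition carries the registers that it tests, increments and decrements.
\<close>

type_synonym cont = "prog list"
type_synonym label = "nat set \<times> nat set \<times> nat set"

fun steps :: "cont \<Rightarrow> (label \<times> cont) set" where
  "steps [] = {}"
| "steps (Test r # K) = {(({r}, {}, {}), K)}"
| "steps (Add A B # K) = {(({}, A, B), K)}"
| "steps (Seq p q # K) = {(({}, {}, {}), p # q # K)}"
| "steps (Star p # K) = {(({}, {}, {}), K), (({}, {}, {}), p # Star p # K)}"

primrec csem :: "cont \<Rightarrow> ((nat \<Rightarrow> int) \<times> (nat \<Rightarrow> int)) set" where
  "csem [] = Id"
| "csem (p # K) = sem p O csem K"

inductive executes :: "cont \<Rightarrow> (nat \<Rightarrow> int) \<Rightarrow> bool" where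
  finished: "executes [] s"
| step: "((Z, A, B), K') \<in> steps K \<Longrightarrow> \<forall>r\<in>Z. s r = 0 \<Longrightarrow>
    executes K' (\<lambda>i. s i + add_sub A B i) \<Longrightarrow> executes K s"

lemma csem_step:
  assumes "((Z, A, B), K') \<in> steps K" "\<forall>r\<in>Z. s r = 0"
    and "(\<lambda>i. s i + add_sub A B i, s') \<in> csem K'"
  shows "(s, s') \<in> csem K"
proof (cases K rule: steps.cases)
  case (5 p L)
  with assms have "(s, s') \<in> csem L \<or> (s, s') \<in> csem (p # Star p # L)"
    by (auto simp: add_sub_def)
  moreover have "sem p O (sem p)\<^sup>* \<subseteq> (sem p)\<^sup>*"
    by (blast intro: converse_rtrancl_into_rtrancl)
  then have "csem (p # Star p # L) \<subseteq> csem K"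
    by (simp add: 5 relcomp_mono flip: O_assoc)
  moreover have "csem L \<subseteq> csem K"
    by (auto simp: 5)
  ultimately show ?thesis by blast
qed (use assms in \<open>auto simp: add_sub_def\<close>)

lemma executes_sound: "executes K s \<Longrightarrow> \<exists>s'. (s, s') \<in> csem K"
proof (induction rule: executes.induct)
  case (step Z A B K' K s)
  then show ?case using csem_step by blast
qed auto

text \<open>With an arbitrary continuation \<open>K\<close> the induction covers sequences, whose
  second part waits in \<open>K\<close>. Loops are unfolded at their beginning, as in
  \<open>steps\<close>.\<close>

lemma executes_complete: "(s, s') \<in> sem p \<Longrightarrow> executes K s' \<Longrightarrow> executes (p # K) s"
proof (induction p arbitrary: s s' K)
  case (Test r)
  then show ?case by - (rule executes.step[of "{r}" "{}" "{}" K], auto simp: add_sub_def)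
next
  case (Add A B)
  then show ?case by - (rule executes.step[of "{}" A B K], auto)
next
  case (Seq p q)
  then obtain t where "(s, t) \<in> sem p" "(t, s') \<in> sem q" by auto
  with Seq have "executes (p # q # K) s" by blast
  then show ?case by - (rule executes.step[of "{}" "{}" "{}" "p # q # K"], auto simp: add_sub_def)
next
  case (Star p)
  from Star.prems(1) have "(s, s') \<in> (sem p)\<^sup>*" by simp
  then show ?case
  proof (induction rule: converse_rtrancl_induct)
    case base
    then show ?case using Star.prems
      by - (rule executes.step[of "{}" "{}" "{}" K], auto simp: add_sub_def)
  next
    case (step y z)
    then have "executes (p # Star p # K) y" using Star.IH by blast
    then show ?case by - (rule executes.step[of "{}" "{}" "{}" "p # Star p # K"], auto simp: add_sub_def)
  qed
qed

lemma executes_iff: "executes [p] s \<longleftrightarrow> (\<exists>s'. (s, s') \<in> sem p)"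
proof
  show "executes [p] s \<Longrightarrow> \<exists>s'. (s, s') \<in> sem p"
    using executes_sound[of "[p]" s] by auto
  assume "\<exists>s'. (s, s') \<in> sem p"
  then obtain s' where "(s, s') \<in> sem p" ..
  then show "executes [p] s" by (rule executes_complete) (rule executes.finished)
qed

text \<open>Each occurrence of a subprogram is entered with one continuation only, because a loop
  body always returns to the same \<open>Star p # K\<close>. So finitely many points suffice for
  runs of any length; the exit \<open>K\<close> is added separately.\<close>

primrec points :: "prog \<Rightarrow> cont \<Rightarrow> cont set" where
  "points (Test r) K = {Test r # K}"
| "points (Add A B) K = {Add A B # K}"
| "points (Seq p q) K = insert (Seq p q # K) (points p (q # K) \<union> points q K)"
| "points (Star p) K = insert (Star p # K) (points p (Star p # K))"

lemma finite_points: "finite (points p K)"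
  by (induction p arbitrary: K) auto

lemma Cons_in_points: "p # K \<in> points p K"
  by (cases p) auto

lemma points_closed: "L \<in> points p K \<Longrightarrow> (l, L') \<in> steps L \<Longrightarrow> L' \<in> insert K (points p K)"
proof (induction p arbitrary: K L)
  case (Seq p q)
  then show ?case using Cons_in_points[of p "q # K"] Cons_in_points[of q K] by fastforce
next
  case (Star p)
  then show ?case using Cons_in_points[of p "Star p # K"] by fastforce
qed auto

lemma finite_steps: "finite (steps K)"
  by (cases K rule: steps.cases) auto

lemma steps_finite_tests: "((Z, A, B), K') \<in> steps K \<Longrightarrow> finite Z"
  by (cases K rule: steps.cases) auto

text \<open>
  An action consists of the set of counters that it tests for zero and of its update vector.
  Counters may become negative.
\<close>

type_synonym action = "nat set \<times> (nat \<Rightarrow> int)"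

primrec accepts :: "nat \<Rightarrow> (nat \<Rightarrow> int) \<Rightarrow> action list \<Rightarrow> bool" where
  "accepts h c [] \<longleftrightarrow> c h = 0"
| "accepts h c (a # w) \<longleftrightarrow> (\<forall>j\<in>fst a. c j = 0) \<and> accepts h (\<lambda>j. c j + snd a j) w"

text \<open>
  Counters below \<open>m\<close> hold the registers; counter \<open>m + e K\<close> is 0 if \<open>K\<close> is the current point
  and 1 otherwise.
\<close>

definition point_counters :: "nat \<Rightarrow> (cont \<Rightarrow> nat) \<Rightarrow> cont \<Rightarrow> (nat \<Rightarrow> int) \<Rightarrow> nat \<Rightarrow> int" where
  "point_counters m e K s j = (if j < m then s j else of_bool (j \<noteq> m + e K))"

text \<open>Zero tests are the only guards available, so the current point is the one marked by 0.
  The test of \<open>m + e K\<close> forces words to follow the control flow. The update raises the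
  counter of \<open>K\<close> from 0 to 1 and lowers that of \<open>K'\<close> from 1 to 0; for
  \<open>K = K'\<close> the two cancel.\<close>

definition step_action :: "nat \<Rightarrow> (cont \<Rightarrow> nat) \<Rightarrow> cont \<Rightarrow> label \<Rightarrow> cont \<Rightarrow> action" where
  "step_action m e K l K' = (case l of (Z, A, B) \<Rightarrow>
    (insert (m + e K) Z, \<lambda>j. if j < m then add_sub A B j else add_sub {m + e K} {m + e K'} j))"

lemma point_counters_step:
  "(\<lambda>j. point_counters m e K s j + snd (step_action m e K (Z, A, B) K') j) =
    point_counters m e K' (\<lambda>i. s i + add_sub A B i)"
  by (auto simp: point_counters_def step_action_def add_sub_def fun_eq_iff)

text \<open>The input \<open>x\<close> affects only the initial values of the first \<open>k\<close>
  counters, as the diagonalisation requires. The bound on the updates limits the factors by which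
  masses have to be scaled.\<close>

theorem program_counter_machine:
  "\<exists>N As h init. k \<le> N \<and> h < N \<and>
    (\<forall>(Z, u)\<in>set As. Z \<subseteq> {..<N} \<and> (\<forall>j. u j \<in> {-1, 0, 1})) \<and>
    (\<forall>x. (\<exists>w. set w \<subseteq> set As \<and> accepts h (ints (\<lambda>j. if j < k then x j else init j)) w) \<longleftrightarrow>
      (\<exists>s. (ints (\<lambda>j. if j < k then x j else 0), s) \<in> sem p))"
proof -
  define C where "C = insert [] (points p [])"
  have C: "finite C" "[] \<in> C" "[p] \<in> C" "\<And>K l K'. K \<in> C \<Longrightarrow> (l, K') \<in> steps K \<Longrightarrow> K' \<in> C"
  proof -
    show "finite C" "[] \<in> C" "[p] \<in> C" using finite_points Cons_in_points by (auto simp: C_def)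
    show "K' \<in> C" if "K \<in> C" "(l, K') \<in> steps K" for K l K'
    proof (cases "K = []")
      case False
      with that have "K \<in> points p []" by (simp add: C_def)
      from points_closed[OF this that(2)] show ?thesis unfolding C_def .
    qed (use that in simp)
  qed
  obtain e n where e: "bij_betw e C {..<n::nat}"
    using C(1) by (metis ex_bij_betw_finite_nat lessThan_atLeast0)
  define T where "T = (\<Union>K\<in>C. \<Union>(l, K')\<in>steps K. fst l)"
  have "finite T"
    using C(1) finite_steps steps_finite_tests unfolding T_def by (fastforce intro!: finite_UN_I)
  \<comment> \<open>\<open>m\<close> exceeds all inputs and all tested registers. Changes of
    registers from \<open>m\<close> on are dropped, as no test can see them.\<close>
  then obtain m where m: "k \<le> m" "T \<subseteq> {..<m}"
    by (metis finite_nat_iff_bounded lessThan_subset_iff nle_le order_trans)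
  define S where "S = (\<Union>K\<in>C. (\<lambda>(l, K'). step_action m e K l K') ` steps K)"
  have "finite S" using C(1) finite_steps by (auto simp: S_def)
  then obtain As where As: "set As = S" using finite_list by blast
  define init where "init j = (if j < m then 0 else of_bool (j \<noteq> m + e [p]) :: nat)" for j
  have less: "e K < n" if "K \<in> C" for K using e that by (auto simp: bij_betw_def)
  have tests: "r < m" if "K \<in> C" "((Z, A, B), K') \<in> steps K" "r \<in> Z" for K Z A B K' r
    using m(2) that by (force simp: T_def)
  have sound: "executes K s" if "K \<in> C" "set w \<subseteq> S" "accepts (m + e []) (point_counters m e K s) w" for K s w
    using that
  proof (induction w arbitrary: K s)
    case Nil
    then have "e K = e []" by (auto simp: point_counters_def split: if_splits)
    then have "K = []" using e C(2) Nil(1) by (auto simp: bij_betw_def dest: inj_onD)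
    then show ?case by (simp add: finished)
  next
    case (Cons a w)
    from Cons.prems obtain L Z A B K' where L: "L \<in> C" "((Z, A, B), K') \<in> steps L" "a = step_action m e L (Z, A, B) K'"
      by (auto simp: S_def)
    have t: "\<forall>j\<in>insert (m + e L) Z. point_counters m e K s j = 0"
      using Cons.prems(3) by (simp add: L(3) step_action_def)
    \<comment> \<open>Among the point counters only that of \<open>K\<close> is 0, so the guard of
      the action identifies its source.\<close>
    then have "e L = e K" by (auto simp: point_counters_def split: if_splits)
    then have K: "K = L" using e L(1) Cons.prems(1) by (auto simp: bij_betw_def dest: inj_onD)
    have "executes K' (\<lambda>i. s i + add_sub A B i)"
      using Cons.prems C(4)[OF L(1,2)] unfolding K L(3)
      by (intro Cons.IH) (auto simp only: accepts.simps point_counters_step list.set)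
    moreover have "\<forall>r\<in>Z. s r = 0"
      using t tests[OF L(1,2)] by (auto simp: point_counters_def)
    ultimately show ?case using L(2) executes.step unfolding K by blast
  qed
  have complete: "\<exists>w. set w \<subseteq> S \<and> accepts (m + e []) (point_counters m e K s) w"
    if "executes K s" "K \<in> C" for K s
    using that
  proof (induction rule: executes.induct)
    case (finished s)
    show ?case by (rule exI[of _ "[]"]) (simp add: point_counters_def)
  next
    case (step Z A B K' K s)
    then obtain w where w: "set w \<subseteq> S"
      "accepts (m + e []) (point_counters m e K' (\<lambda>i. s i + add_sub A B i)) w"
      using C(4) by blast
    let ?a = "step_action m e K (Z, A, B) K'"
    have "?a \<in> S" using step by (force simp: S_def)
    moreover have "\<forall>j\<in>fst ?a. point_counters m e K s j = 0"
      using step tests[OF step.prems step.hyps(1)] by (auto simp: step_action_def point_counters_def)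
    ultimately have "set (?a # w) \<subseteq> S \<and> accepts (m + e []) (point_counters m e K s) (?a # w)"
      using w by (simp add: point_counters_step)
    then show ?case by blast
  qed
  have eq: "ints (\<lambda>j. if j < k then x j else init j) =
      point_counters m e [p] (ints (\<lambda>j. if j < k then x j else 0))" for x
    using m(1) by (auto simp: init_def point_counters_def fun_eq_iff)
  have bounds: "Z \<subseteq> {..<m + n} \<and> (\<forall>j. u j \<in> {-1, 0, 1})" if "(Z, u) \<in> set As" for Z u
  proof -
    from that obtain K Z' A B K' where K: "K \<in> C" "((Z', A, B), K') \<in> steps K"
      and "(Z, u) = step_action m e K (Z', A, B) K'"
      unfolding As S_def by auto
    then have Z: "Z = insert (m + e K) Z'"
      and u: "u = (\<lambda>j. if j < m then add_sub A B j else add_sub {m + e K} {m + e K'} j)"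
      by (simp_all add: step_action_def)
    have "Z \<subseteq> {..<m + n}"
      using tests[OF K] less[OF K(1)] by (auto simp: Z intro: trans_less_add1)
    then show ?thesis by (auto simp: u add_sub_def)
  qed
  show ?thesis
  proof (intro exI conjI allI)
    show "k \<le> m + n" "m + e [] < m + n" using m(1) less[OF C(2)] by auto
    show "\<forall>(Z, u)\<in>set As. Z \<subseteq> {..<m + n} \<and> (\<forall>j. u j \<in> {-1, 0, 1})" using bounds by blast
    show "(\<exists>w. set w \<subseteq> set As \<and> accepts (m + e []) (ints (\<lambda>j. if j < k then x j else init j)) w) \<longleftrightarrow>
        (\<exists>s. (ints (\<lambda>j. if j < k then x j else 0), s) \<in> sem p)" for x
      using sound[OF C(3)] complete[OF _ C(3)] unfolding eq As executes_iff by blast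
  qed
qed

section \<open>Reachability in Markov decision processes\<close>

lemma reachable_history_word:
  "p \<in> reachable_histories M d0 k \<Longrightarrow> \<exists>w. set w \<subseteq> actions M \<and> last p = foldl (successor M) d0 w"
proof (induction k arbitrary: p)
  case 0
  show ?case by (rule exI[of _ "[]"]) (use 0 in simp)
next
  case (Suc k)
  then obtain q a where q: "q \<in> reachable_histories M d0 k" "a \<in> actions M" "p = q @ [successor M (last q) a]"
    by auto
  from Suc.IH[OF q(1)] obtain w where "set w \<subseteq> actions M" "last q = foldl (successor M) d0 w" by blast
  then show ?case by (intro exI[of _ "w @ [a]"]) (use q in simp)
qed

text \<open>At each time the path almost surely follows one of finitely many histories, all ending
  in configurations produced by words. The countably many times give a null event.\<close>

lemma Reach_null:
  assumes M: "is_mdp M" "scheduler M \<sigma>" "d0 \<in> configs M"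
    and no: "\<And>w. set w \<subseteq> actions M \<Longrightarrow> config_vec (states M) (foldl (successor M) d0 w) \<notin> H"
  shows "measure (path_measure M \<sigma> d0) (Reach M d0 H) = 0"
proof -
  define P where "P = path_measure M \<sigma> d0"
  have P: "induced_measure M \<sigma> d0 P" unfolding P_def by (rule path_measure[OF M])
  interpret prob_space P using P by (simp add: induced_measure_def)
  have sP: "sets P = sets (path_space M)" using P by (simp add: induced_measure_def)
  have "AE \<omega> in P. config_vec (states M) (\<omega> k) \<notin> H" for k
  proof -
    let ?R = "reachable_histories M d0 k"
    have R: "finite ?R" "\<And>p. p \<in> ?R \<Longrightarrow> length p = Suc k \<and> p \<in> nonempty_seqs (configs M)"
      using reachable_histories[OF M(1,3)] by auto
    have "disjoint_family_on (cylinder M) ?R"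
      using R(2) cylinder_disjoint unfolding disjoint_family_on_def by metis
    then have "measure P (\<Union>p\<in>?R. cylinder M p) = 1"
      using induced_measure_support[OF M P, of k] R cylinder_sets
      by (subst finite_measure_finite_Union) (auto simp: sP)
    then have "AE \<omega> in P. \<omega> \<in> (\<Union>p\<in>?R. cylinder M p)"
      using R cylinder_sets sP by (subst (asm) prob_eq_1) (auto intro!: sets.finite_UN)
    then show ?thesis
    proof eventually_elim
      case (elim \<omega>)
      then obtain p where p: "p \<in> ?R" "\<omega> \<in> cylinder M p" by blast
      have "\<omega> k = p ! k" "last p = p ! k"
        using R(2)[OF p(1)] p(2) by (auto simp: cylinder_def last_conv_nth nonempty_seqs_def)
      then show ?case using reachable_history_word[OF p(1)] no by auto
    qed
  qed
  then have "AE \<omega> in P. \<forall>k. config_vec (states M) (\<omega> k) \<notin> H"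
    by (simp add: AE_all_countable)
  then have "AE \<omega> in P. \<omega> \<notin> Reach M d0 H"
    by eventually_elim (auto simp: Reach_def)
  then show ?thesis
    using Reach_sets by (subst P_def[symmetric], subst prob_eq_0) (auto simp: sP)
qed

text \<open>Randomisation only mixes words: if some scheduler reaches \<open>H\<close> with positive
  probability, some word does so with certainty, since its transitions are deterministic on
  configurations.\<close>

theorem almost_sure_reach_iff_word:
  assumes M: "is_mdp M" "d0 \<in> configs M" and act: "actions M \<noteq> {}"
  shows "(\<exists>\<sigma>. scheduler M \<sigma> \<and> measure (path_measure M \<sigma> d0) (Reach M d0 H) \<ge> 1) \<longleftrightarrow>
    (\<exists>w. set w \<subseteq> actions M \<and> config_vec (states M) (foldl (successor M) d0 w) \<in> H)"
    (is "?L \<longleftrightarrow> ?R")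
proof
  assume ?L
  then obtain \<sigma> where \<sigma>: "scheduler M \<sigma>" "measure (path_measure M \<sigma> d0) (Reach M d0 H) \<ge> 1" by blast
  show ?R
  proof (rule ccontr)
    assume "\<not> ?R"
    then have "measure (path_measure M \<sigma> d0) (Reach M d0 H) = 0"
      by (intro Reach_null M \<sigma>(1)) blast
    with \<sigma>(2) show False by simp
  qed
next
  assume ?R
  then obtain w where w: "set w \<subseteq> actions M" "config_vec (states M) (foldl (successor M) d0 w) \<in> H" by blast
  from act obtain a0 where a0: "a0 \<in> actions M" by blast
  \<comment> \<open>A history of \<open>k + 1\<close> configurations has seen \<open>k\<close>
    actions, so its length tells which letter comes next. After the end of \<open>w\<close> the
    default \<open>a0\<close> is played; the target has been visited by then.\<close>
  define act where "act k = (if k < length w then w ! k else a0)" for k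
  define \<sigma> where "\<sigma> p = return_pmf (act (length p - 1))" for p :: "'a pmf list"
  have act: "act k \<in> actions M" for k using w(1) a0 by (auto simp: act_def)
  then have \<sigma>: "scheduler M \<sigma>" by (auto simp: scheduler_def \<sigma>_def distributions_def)
  define P where "P = path_measure M \<sigma> d0"
  have P: "induced_measure M \<sigma> d0 P" unfolding P_def by (rule path_measure[OF M(1) \<sigma> M(2)])
  interpret prob_space P using P by (simp add: induced_measure_def)
  define c where "c j = foldl (successor M) d0 (take j w)" for j
  have c: "c j \<in> configs M" for j
  proof -
    have "foldl (successor M) d0 v \<in> configs M" if "set v \<subseteq> actions M" for v
      using that by (induction v rule: rev_induct) (auto simp: M successor_in_configs)
    then show ?thesis unfolding c_def using w(1) by (meson order_trans set_take_subset)
  qed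
  have fin: "finite (actions M)" using M by (simp add: is_mdp_def)
  have "measure P (cylinder M (map c [0..<Suc i])) = 1" if "i \<le> length w" for i
    using that
  proof (induction i)
    case 0
    then show ?case using P by (simp add: induced_measure_def c_def)
  next
    case (Suc i)
    let ?p = "map c [0..<Suc i]"
    have p: "?p \<in> nonempty_seqs (configs M)" using c by (auto simp: nonempty_seqs_def)
    have last: "last ?p = c i" by simp
    have "c (Suc i) = successor M (c i) (act i)"
      using Suc.prems by (simp add: c_def act_def take_Suc_conv_app_nth)
    then have "move_prob M \<sigma> ?p (c (Suc i)) = 1"
      using act fin unfolding move_prob_def last \<sigma>_def
      by (subst measure_measure_pmf_finite[symmetric]) (auto simp: measure_return_pmf)
    moreover have "measure P (cylinder M ?p) = 1" using Suc by simp
    ultimately have "measure P (cylinder M (?p @ [c (Suc i)])) = 1"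
      using P p c unfolding induced_measure_def by (metis mult_1)
    then show ?case by simp
  qed
  from this[of "length w"] have "1 \<le> measure P (cylinder M (map c [0..<Suc (length w)]))" by simp
  also have "\<dots> \<le> measure P (Reach M d0 H)"
  proof (rule finite_measure_mono)
    have "\<omega> 0 = d0 \<and> config_vec (states M) (\<omega> (length w)) \<in> H \<and> \<omega> \<in> space (path_space M)"
      if "\<omega> \<in> cylinder M (map c [0..<Suc (length w)])" for \<omega>
      using that w(2) by (force simp: cylinder_def c_def nth_append less_Suc_eq simp del: upt_Suc)
    then show "cylinder M (map c [0..<Suc (length w)]) \<subseteq> Reach M d0 H"
      unfolding Reach_def by blast
    show "Reach M d0 H \<in> sets P" using P Reach_sets by (simp add: induced_measure_def)
  qed
  finally show ?L using \<sigma> unfolding P_def by blast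
qed

text \<open>An uncomputable choice is harmless here: only transition probabilities are converted,
  and the code of their table enters the diagonal argument as a given number. The initial table,
  which varies with the input, has explicit fractions.\<close>

definition to_frac :: "real \<Rightarrow> frac" where
  "to_frac x = (SOME r. valid_frac r \<and> frac_val r = x)"

lemma to_frac:
  assumes "x \<in> \<rat>" "0 \<le> x" "x \<le> 1"
  shows "valid_frac (to_frac x)" "frac_val (to_frac x) = x"
proof -
  from Rats_abs_nat_div_natE[OF assms(1)] obtain m n :: nat where n: "n \<noteq> 0" "\<bar>x\<bar> = real m / real n"
    by metis
  then have "valid_frac (m, n) \<and> frac_val (m, n) = x"
    using assms by (simp add: valid_frac_def frac_val_def divide_le_eq)
  from someI[of "\<lambda>r. valid_frac r \<and> frac_val r = x", OF this]
  show "valid_frac (to_frac x)" "frac_val (to_frac x) = x"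
    by (simp_all add: to_frac_def)
qed

lemma sum_lessThan_add_2: "(\<Sum>q<n + 2. f q) = (\<Sum>q<n. f q) + f n + f (n + 1)" for f :: "nat \<Rightarrow> real"
  by (simp add: numeral_2_eq_2)

lemma block_div_mod:
  "(5 * j) mod 5 = 0" "(5 * j + 1) mod 5 = 1" "(5 * j + 2) mod 5 = 2" "(5 * j + 3) mod 5 = 3" "(5 * j + 4) mod 5 = 4"
  "(5 * j) div 5 = j" "(5 * j + 1) div 5 = j" "(5 * j + 2) div 5 = j" "(5 * j + 3) div 5 = j" "(5 * j + 4) div 5 = j"
  for j :: nat
  by presburger+

lemma sum_blocks_of_5:
  "(\<Sum>q<5 * N. f q) = (\<Sum>j<N. f (5 * j) + f (5 * j + 1) + f (5 * j + 2) + f (5 * j + 3) + f (5 * j + 4))"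
  for f :: "nat \<Rightarrow> real"
  by (induction N) (simp_all add: add.assoc eval_nat_numeral)

text \<open>
  Counter \<open>j\<close> with value \<open>c j\<close> is represented by the masses $m$, $m x$ and $m x^2$, where
  $x = 2^{-c_j}$, of the states $5j$, $5j+1$ and $5j+3$; the states $5j+2$ and $5j+4$
  only fill up the initial distribution. Every action scales $m$ by $1/8$ and splits the remaining
  mass evenly between the accepting state $5N$ and the rejecting state $5N+1$, except that a zero test of
  counter \<open>j\<close> shifts the balance by $m/4 \cdot (1 - x)^2$ in favour of the rejecting state. The final
  action, whose index is the number of proper actions, tests \<open>h\<close> and distributes all the mass.
\<close>

definition half_pow :: "int \<Rightarrow> real" where
  "half_pow z = 2 powr - real_of_int z"

definition stay :: "action list \<Rightarrow> nat \<Rightarrow> nat \<Rightarrow> real" where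
  "stay As a q = (if a \<ge> length As then 0
    else if q mod 5 = 0 then 1 / 8
    else if q mod 5 = 1 then half_pow (snd (As ! a) (q div 5)) / 8
    else if q mod 5 = 3 then (half_pow (snd (As ! a) (q div 5)))\<^sup>2 / 8
    else 0)"

definition tested :: "action list \<Rightarrow> nat \<Rightarrow> nat \<Rightarrow> nat set" where
  "tested As h a = (if a < length As then fst (As ! a) else {h})"

definition bias :: "action list \<Rightarrow> nat \<Rightarrow> nat \<Rightarrow> nat \<Rightarrow> real" where
  "bias As h a q = (if q div 5 \<notin> tested As h a then 0
    else if q mod 5 = 0 \<or> q mod 5 = 3 then - 1 / 4
    else if q mod 5 = 1 then 1 / 2
    else 0)"

definition trans_prob :: "nat \<Rightarrow> action list \<Rightarrow> nat \<Rightarrow> nat \<Rightarrow> nat \<Rightarrow> nat \<Rightarrow> real" where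
  "trans_prob N As h a q q' =
    (if q < 5 * N then
       (if q' = q then stay As a q
        else if q' = 5 * N then (1 - stay As a q + bias As h a q) / 2
        else if q' = 5 * N + 1 then (1 - stay As a q - bias As h a q) / 2
        else 0)
     else of_bool (q' = q))"

text \<open>Every counter receives mass $1/N$ whatever its value: a third on state $5j$, a third on
  the pair $5j+1$, $5j+2$ and a third on the pair $5j+3$, $5j+4$. Leaving the fractions unreduced
  keeps their codes simple arithmetic functions of the input.\<close>

definition init_frac :: "nat \<Rightarrow> (nat \<Rightarrow> nat) \<Rightarrow> nat \<Rightarrow> frac" where
  "init_frac N x q =
    (if q \<ge> 5 * N then (0, 1)
     else if q mod 5 = 0 then (1, 3 * N)
     else if q mod 5 = 1 then (1, 3 * N * 2 ^ x (q div 5))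
     else if q mod 5 = 2 then (2 ^ x (q div 5) - 1, 3 * N * 2 ^ x (q div 5))
     else if q mod 5 = 3 then (1, 3 * N * 4 ^ x (q div 5))
     else (4 ^ x (q div 5) - 1, 3 * N * 4 ^ x (q div 5)))"

definition machine_instance :: "nat \<Rightarrow> action list \<Rightarrow> nat \<Rightarrow> (nat \<Rightarrow> nat) \<Rightarrow> reach_instance" where
  "machine_instance N As h x =
    \<lparr>num_states = 5 * N + 2,
     num_actions = Suc (length As),
     trans_table = map (\<lambda>q. map (\<lambda>a. map (\<lambda>q'. to_frac (trans_prob N As h a q q')) [0..<5 * N + 2])
       [0..<Suc (length As)]) [0..<5 * N + 2],
     init_table = map (init_frac N x) [0..<5 * N + 2],
     upward = True,
     generators = [map (\<lambda>q. if q = 5 * N then (1, 2) else (0, 1)) [0..<5 * N + 2]],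
     threshold = (1, 1)\<rparr>"

lemma half_pow_add: "half_pow (a + b) = half_pow a * half_pow b"
  by (simp add: half_pow_def powr_add[symmetric])

lemma half_pow_eq_1_iff [simp]: "half_pow z = 1 \<longleftrightarrow> z = 0"
  by (simp add: half_pow_def)

lemma half_pow_int: "half_pow (int n) = 1 / 2 ^ n"
  by (simp add: half_pow_def powr_minus powr_realpow divide_inverse)

section \<open>Validity and transitions of the simulating instance\<close>

locale counter_machine =
  fixes N :: nat and As :: "action list" and h :: nat
  assumes action_bounds: "\<forall>(Z, u)\<in>set As. Z \<subseteq> {..<N} \<and> (\<forall>j. u j \<in> {-1, 0, 1})"
    and h: "h < N"
begin

lemma action_bounds_nth:
  assumes "a < length As"
  shows "fst (As ! a) \<subseteq> {..<N}" "snd (As ! a) j \<in> {-1, 0, 1}"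
proof -
  obtain Z u where a: "As ! a = (Z, u)" by (cases "As ! a")
  from bspec[OF action_bounds nth_mem[OF assms]]
  have "Z \<subseteq> {..<N}" "u j \<in> {-1, 0, 1}" unfolding a by simp_all
  then show "fst (As ! a) \<subseteq> {..<N}" "snd (As ! a) j \<in> {-1, 0, 1}" unfolding a by simp_all
qed

lemma half_pow_update:
  assumes "a < length As"
  shows "half_pow (snd (As ! a) j) \<in> {2, 1, 1 / 2}"
  using action_bounds_nth(2)[OF assms, of j] by (auto simp: half_pow_def powr_minus)

lemma tested_subset: "tested As h a \<subseteq> {..<N}"
  using action_bounds_nth(1)[of a] h unfolding tested_def by (cases "a < length As") simp_all

text \<open>This explains the scale $1/8$: decrementing multiplies $m x^2$ by at most $4/8$, so at
  least half of the mass of each state moves on. That covers the largest bias $1/2$ and keeps both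
  absorption probabilities nonnegative.\<close>

lemma stay_bias:
  shows "0 \<le> stay As a q" "\<bar>bias As h a q\<bar> \<le> 1 - stay As a q"
    and "stay As a q \<in> \<rat>" "bias As h a q \<in> \<rat>"
proof -
  define y where "y = (if a < length As then half_pow (snd (As ! a) (q div 5)) else 1)"
  have y: "y = 2 \<or> y = 1 \<or> y = 1 / 2" using half_pow_update[of a "q div 5"] by (auto simp: y_def)
  have "stay As a q = (if a \<ge> length As then 0 else if q mod 5 = 0 then 1 / 8
      else if q mod 5 = 1 then y / 8 else if q mod 5 = 3 then y\<^sup>2 / 8 else 0)"
    by (simp add: stay_def y_def)
  then have "stay As a q \<in> {0, 1 / 8, y / 8, y\<^sup>2 / 8}" by simp
  moreover have "{0, 1 / 8, y / 8, y\<^sup>2 / 8} \<subseteq> {0, 1 / 8, 1 / 4, 1 / 16, 1 / 2, 1 / 32}"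
    using y by (elim disjE; simp only: power2_eq_square; simp)
  ultimately have stay: "stay As a q \<in> {0, 1 / 8, 1 / 4, 1 / 16, 1 / 2, 1 / 32}" by blast
  moreover have "{0, 1 / 8, 1 / 4, 1 / 16, 1 / 2, 1 / 32} \<subseteq> (\<rat> :: real set) \<inter> {0..}" by simp
  ultimately show "0 \<le> stay As a q" "stay As a q \<in> \<rat>" by blast+
  show "\<bar>bias As h a q\<bar> \<le> 1 - stay As a q" using stay by (auto simp: bias_def)
  show "bias As h a q \<in> \<rat>" by (auto simp: bias_def)
qed

lemma trans_prob_bounds:
  shows "0 \<le> trans_prob N As h a q q'" "trans_prob N As h a q q' \<le> 1"
    and "trans_prob N As h a q q' \<in> \<rat>"
  using stay_bias[of a q] by (auto simp: trans_prob_def abs_le_iff)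

lemma sum_trans_prob:
  assumes "q < 5 * N + 2"
  shows "(\<Sum>q'<5 * N + 2. trans_prob N As h a q q') = 1"
proof -
  show ?thesis
  proof (cases "q < 5 * N")
    case True
    have "(\<Sum>q'<5 * N. trans_prob N As h a q q') = (\<Sum>q'<5 * N. if q' = q then stay As a q else 0)"
      using True by (intro sum.cong) (auto simp: trans_prob_def)
    with True show ?thesis unfolding sum_lessThan_add_2 by (auto simp: trans_prob_def field_simps)
  next
    case False
    then have "q = 5 * N \<or> q = 5 * N + 1" using assms by auto
    then show ?thesis unfolding sum_lessThan_add_2 by (auto simp: trans_prob_def)
  qed
qed

abbreviation "inst \<equiv> machine_instance N As h"

lemma sum_init_frac: "(\<Sum>q<5 * N + 2. frac_val (init_frac N x q)) = 1"
proof -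
  have "(\<Sum>q<5 * N + 2. frac_val (init_frac N x q)) = (\<Sum>q<5 * N. frac_val (init_frac N x q))"
    by (simp add: sum_lessThan_add_2 init_frac_def frac_val_def)
  also have "\<dots> = (\<Sum>j<N. 1 / real N)"
    unfolding sum_blocks_of_5
  proof (intro sum.cong refl)
    fix j assume j: "j \<in> {..<N}"
    have lt: "5 * j < 5 * N" "5 * j + 1 < 5 * N" "5 * j + 2 < 5 * N" "5 * j + 3 < 5 * N" "5 * j + 4 < 5 * N"
      using j by auto
    have v: "frac_val (init_frac N x (5 * j)) = 1 / (3 * real N)"
      "frac_val (init_frac N x (5 * j + 1)) = 1 / (3 * real N * 2 ^ x j)"
      "frac_val (init_frac N x (5 * j + 2)) = (2 ^ x j - 1) / (3 * real N * 2 ^ x j)"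
      "frac_val (init_frac N x (5 * j + 3)) = 1 / (3 * real N * 4 ^ x j)"
      "frac_val (init_frac N x (5 * j + 4)) = (4 ^ x j - 1) / (3 * real N * 4 ^ x j)"
      using lt unfolding init_frac_def block_div_mod frac_val_def by (simp_all add: of_nat_diff)
    show "frac_val (init_frac N x (5 * j)) + frac_val (init_frac N x (5 * j + 1)) +
        frac_val (init_frac N x (5 * j + 2)) + frac_val (init_frac N x (5 * j + 3)) +
        frac_val (init_frac N x (5 * j + 4)) = 1 / real N"
      using h unfolding v by (simp add: field_simps)
  qed
  also have "\<dots> = 1" using h by simp
  finally show ?thesis .
qed

lemma valid_trans_row:
  assumes "q < 5 * N + 2"
  shows "valid_distr (5 * N + 2) (map (\<lambda>q'. to_frac (trans_prob N As h a q q')) [0..<5 * N + 2])"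
proof -
  have "(\<Sum>q'\<leftarrow>[0..<5 * N + 2]. trans_prob N As h a q q') = (\<Sum>q'<5 * N + 2. trans_prob N As h a q q')"
    by (simp only: interv_sum_list_conv_sum_set_nat set_upt atLeast_upt lessThan_atLeast0)
  then show ?thesis
    using to_frac[OF trans_prob_bounds(3,1,2)] sum_trans_prob[OF assms]
    by (simp add: valid_distr_def valid_vec_def comp_def del: upt_Suc)
qed

lemma valid_init: "valid_distr (5 * N + 2) (map (init_frac N x) [0..<5 * N + 2])"
  proof -
    have "(\<Sum>q\<leftarrow>[0..<5 * N + 2]. frac_val (init_frac N x q)) = (\<Sum>q<5 * N + 2. frac_val (init_frac N x q))"
      by (simp only: interv_sum_list_conv_sum_set_nat set_upt lessThan_atLeast0)
    moreover have "valid_frac (init_frac N x q)" for q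
    proof -
      have "a - 1 \<le> 3 * N * a" "a \<ge> 1 \<Longrightarrow> 1 \<le> 3 * N * a" for a
        using h by (simp_all add: Suc_le_eq trans_le_add1 mult_eq_if)
      then show ?thesis using h by (auto simp: init_frac_def valid_frac_def)
    qed
    ultimately show ?thesis
      using sum_init_frac by (simp add: valid_distr_def valid_vec_def comp_def del: upt_Suc)
qed

lemma valid_machine_instance: "valid_instance (inst x)"
  unfolding valid_instance_def
proof (intro conjI ballI)
  fix row v
  assume "row \<in> set (trans_table (inst x))" "v \<in> set row"
  then show "valid_distr (num_states (inst x)) v"
    using valid_trans_row by (auto simp: machine_instance_def simp del: upt_Suc)
next
  show "valid_distr (num_states (inst x)) (init_table (inst x))"
    using valid_init by (simp add: machine_instance_def del: upt_Suc)
qed (auto simp: machine_instance_def valid_vec_def valid_frac_def simp del: upt_Suc)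

lemma mdp_inst:
  "states (mdp_of (inst x)) = {..<5 * N + 2}" "actions (mdp_of (inst x)) = {..length As}"
  by (auto simp: mdp_of_def machine_instance_def)

lemma pmf_trans_inst:
  assumes "q < 5 * N + 2" "a \<le> length As" "q' < 5 * N + 2"
  shows "pmf (trans (mdp_of (inst x)) q a) q' = trans_prob N As h a q q'"
proof -
  let ?v = "map (\<lambda>q'. to_frac (trans_prob N As h a q q')) [0..<5 * N + 2]"
  have v: "trans_table (inst x) ! q ! a = ?v"
    using assms by (simp add: machine_instance_def less_Suc_eq_le del: upt_Suc)
  from pmf_distr_of[OF valid_trans_row[OF assms(1), of a], of q'] show ?thesis
    using assms to_frac[OF trans_prob_bounds(3,1,2)] by (simp add: mdp_of_def v del: upt_Suc)
qed

lemma pmf_init_inst: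
  assumes "j < N"
  shows "pmf (init_of (inst x)) (5 * j) = 1 / (3 * real N)"
    "pmf (init_of (inst x)) (5 * j + 1) = 1 / (3 * real N) * half_pow (int (x j))"
    "pmf (init_of (inst x)) (5 * j + 3) = 1 / (3 * real N) * (half_pow (int (x j)))\<^sup>2"
proof -
  have "init_of (inst x) = distr_of (map (init_frac N x) [0..<5 * N + 2])"
    by (simp add: init_of_def machine_instance_def)
  then have eq: "pmf (init_of (inst x)) q = frac_val (init_frac N x q)" if "q < 5 * N + 2" for q
    using pmf_distr_of[OF valid_init[of x], of q] that by (simp del: upt_Suc)
  have lt: "5 * j < 5 * N" "5 * j + 1 < 5 * N" "5 * j + 3 < 5 * N" using assms by auto
  have four: "(4 :: real) ^ n = 2 ^ n * 2 ^ n" for n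
    by (simp add: power_mult_distrib[symmetric])
  show "pmf (init_of (inst x)) (5 * j) = 1 / (3 * real N)"
    using lt by (subst eq) (auto simp: init_frac_def frac_val_def)
  show "pmf (init_of (inst x)) (5 * j + 1) = 1 / (3 * real N) * half_pow (int (x j))"
    using lt by (subst eq, simp, unfold init_frac_def block_div_mod frac_val_def) (simp add: half_pow_int)
  show "pmf (init_of (inst x)) (5 * j + 3) = 1 / (3 * real N) * (half_pow (int (x j)))\<^sup>2"
    using lt by (subst eq, simp, unfold init_frac_def block_div_mod frac_val_def)
      (simp add: half_pow_int power2_eq_square four)
qed

lemma init_balanced: "pmf (init_of (inst x)) (5 * N) = 0" "pmf (init_of (inst x)) (5 * N + 1) = 0"
proof -
  have "init_of (inst x) = distr_of (map (init_frac N x) [0..<5 * N + 2])"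
    by (simp add: init_of_def machine_instance_def)
  then have "pmf (init_of (inst x)) q = frac_val (init_frac N x q)" if "q < 5 * N + 2" for q
    using pmf_distr_of[OF valid_init[of x], of q] that by (simp del: upt_Suc)
  then show "pmf (init_of (inst x)) (5 * N) = 0" "pmf (init_of (inst x)) (5 * N + 1) = 0"
    by (simp_all add: init_frac_def frac_val_def)
qed

lemma target_inst:
  "config_vec (states (mdp_of (inst x))) d \<in> target_of (inst x) \<longleftrightarrow> 1 / 2 \<le> pmf d (5 * N)"
proof -
  have "vec_of (map (\<lambda>q. if q = 5 * N then (1, 2) else (0, 1)) [0..<5 * N + 2]) =
      restrict (\<lambda>q. if q = 5 * N then 1 / 2 else 0) {..<5 * N + 2}"
    by (auto simp: vec_of_def frac_val_def fun_eq_iff simp del: upt_Suc)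
  moreover have "config_vec {..<5 * N + 2} d \<in> cube {..<5 * N + 2}"
    by (auto simp: config_vec_def cube_def pmf_le_1)
  ultimately show ?thesis
    by (simp add: target_of_def machine_instance_def mdp_of_def up_closure_def config_vec_def del: upt_Suc)
qed

section \<open>The invariant maintained along a word\<close>

definition balance :: "nat pmf \<Rightarrow> real" where
  "balance d = pmf d (5 * N) - pmf d (5 * N + 1)"

definition represents :: "nat pmf \<Rightarrow> real \<Rightarrow> (nat \<Rightarrow> int) \<Rightarrow> bool" where
  "represents d m c \<longleftrightarrow> (\<forall>j<N. pmf d (5 * j) = m \<and> pmf d (5 * j + 1) = m * half_pow (c j) \<and>
    pmf d (5 * j + 3) = m * (half_pow (c j))\<^sup>2)"

definition penalty :: "real \<Rightarrow> (nat \<Rightarrow> int) \<Rightarrow> nat set \<Rightarrow> real" where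
  "penalty m c Z = m / 4 * (\<Sum>j\<in>Z. (1 - half_pow (c j))\<^sup>2)"

lemma penalty_nonneg: "0 \<le> m \<Longrightarrow> 0 \<le> penalty m c Z"
  by (simp add: penalty_def sum_nonneg)

text \<open>A sum of squares vanishes only termwise, so several failed tests in one action cannot
  compensate each other.\<close>

lemma penalty_eq_0_iff:
  assumes "0 < m" "finite Z"
  shows "penalty m c Z = 0 \<longleftrightarrow> (\<forall>j\<in>Z. c j = 0)"
proof -
  have "1 = half_pow z \<longleftrightarrow> z = 0" for z using half_pow_eq_1_iff[of z] by auto
  with assms show ?thesis by (auto simp: penalty_def sum_nonneg_eq_0_iff)
qed

context
  fixes x :: "nat \<Rightarrow> nat" and d :: "nat pmf" and a :: nat
  assumes d: "d \<in> configs (mdp_of (inst x))" and a: "a \<le> length As"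
begin

abbreviation (input) "d' \<equiv> successor (mdp_of (inst x)) d a"

lemma pmf_successor_inst:
  assumes "q' < 5 * N + 2"
  shows "pmf d' q' = (\<Sum>q<5 * N. pmf d q * trans_prob N As h a q q') +
    (if q' \<ge> 5 * N then pmf d q' else 0)"
proof -
  have "pmf d' q' = (\<Sum>q<5 * N + 2. pmf d q * pmf (trans (mdp_of (inst x)) q a) q')"
    using pmf_successor[OF _ d, of a q'] by (simp add: mdp_inst)
  also have "\<dots> = (\<Sum>q<5 * N + 2. pmf d q * trans_prob N As h a q q')"
    using a assms by (intro sum.cong) (auto simp: pmf_trans_inst)
  also have "\<dots> = (\<Sum>q<5 * N. pmf d q * trans_prob N As h a q q') + (if q' \<ge> 5 * N then pmf d q' else 0)"
  proof -
    from assms consider "q' < 5 * N" | "q' = 5 * N" | "q' = 5 * N + 1" by linarith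
    then show ?thesis
      unfolding sum_lessThan_add_2 by cases (auto simp: trans_prob_def)
  qed
  finally show ?thesis .
qed

lemma pmf_successor_transient:
  assumes "q' < 5 * N"
  shows "pmf d' q' = pmf d q' * stay As a q'"
proof -
  have "(\<Sum>q<5 * N. pmf d q * trans_prob N As h a q q') =
      (\<Sum>q<5 * N. if q = q' then pmf d q' * stay As a q' else 0)"
    using assms by (intro sum.cong) (auto simp: trans_prob_def)
  with assms show ?thesis by (simp add: pmf_successor_inst)
qed

lemma balance_successor_sum:
  "balance d' = balance d + (\<Sum>q<5 * N. pmf d q * bias As h a q)"
proof -
  have "(\<Sum>q<5 * N. pmf d q * trans_prob N As h a q (5 * N)) -
      (\<Sum>q<5 * N. pmf d q * trans_prob N As h a q (5 * N + 1)) = (\<Sum>q<5 * N. pmf d q * bias As h a q)"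
    unfolding sum_subtractf[symmetric]
    by (intro sum.cong) (auto simp: trans_prob_def field_simps)
  then show ?thesis by (simp add: balance_def pmf_successor_inst)
qed

lemma balance_successor:
  assumes "represents d m c"
  shows "balance d' = balance d - penalty m c (tested As h a)"
proof -
  have "(\<Sum>q<5 * N. pmf d q * bias As h a q) =
      (\<Sum>j<N. if j \<in> tested As h a then - (m / 4 * (1 - half_pow (c j))\<^sup>2) else 0)"
    unfolding sum_blocks_of_5
  proof (intro sum.cong refl)
    fix j assume "j \<in> {..<N}"
    then have r: "pmf d (5 * j) = m" "pmf d (5 * j + 1) = m * half_pow (c j)"
      "pmf d (5 * j + 3) = m * (half_pow (c j))\<^sup>2"
      using assms by (auto simp: represents_def)
    show "pmf d (5 * j) * bias As h a (5 * j) + pmf d (5 * j + 1) * bias As h a (5 * j + 1) +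
        pmf d (5 * j + 2) * bias As h a (5 * j + 2) + pmf d (5 * j + 3) * bias As h a (5 * j + 3) +
        pmf d (5 * j + 4) * bias As h a (5 * j + 4) =
        (if j \<in> tested As h a then - (m / 4 * (1 - half_pow (c j))\<^sup>2) else 0)"
      unfolding r bias_def block_div_mod by (simp add: power2_eq_square algebra_simps)
  qed
  also have "\<dots> = (\<Sum>j\<in>tested As h a. - (m / 4 * (1 - half_pow (c j))\<^sup>2))"
    using tested_subset by (subst sum.inter_restrict[symmetric]) (auto simp: Int_absorb1)
  also have "\<dots> = - penalty m c (tested As h a)"
    by (simp add: penalty_def sum_negf sum_distrib_left)
  finally show ?thesis by (simp add: balance_successor_sum)
qed

text \<open>\<open>half_pow\<close> turns the addition of an update into multiplication by a
  constant of the action, which is a linear operation on masses. The common factor $1/8$ goes into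
  the scale.\<close>

lemma represents_successor:
  assumes "represents d m c" "a < length As"
  shows "represents d' (m / 8) (\<lambda>j. c j + snd (As ! a) j)"
  unfolding represents_def
proof (intro allI impI)
  fix j assume "j < N"
  then have lt: "5 * j < 5 * N" "5 * j + 1 < 5 * N" "5 * j + 3 < 5 * N"
    and r: "pmf d (5 * j) = m" "pmf d (5 * j + 1) = m * half_pow (c j)"
      "pmf d (5 * j + 3) = m * (half_pow (c j))\<^sup>2"
    using assms by (auto simp: represents_def)
  show "pmf d' (5 * j) = m / 8 \<and> pmf d' (5 * j + 1) = m / 8 * half_pow (c j + snd (As ! a) j) \<and>
      pmf d' (5 * j + 3) = m / 8 * (half_pow (c j + snd (As ! a) j))\<^sup>2"
    unfolding lt[THEN pmf_successor_transient] r stay_def block_div_mod half_pow_add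
    using assms(2) by (simp add: power_mult_distrib)
qed

end

section \<open>Words into the target versus accepted words\<close>

lemma sum_config:
  assumes "d \<in> configs (mdp_of (inst x))"
  shows "(\<Sum>q<5 * N. pmf d q) + pmf d (5 * N) + pmf d (5 * N + 1) = 1"
proof -
  have "set_pmf d \<subseteq> {..<5 * N + 2}"
    using assms unfolding mdp_inst(1) distributions_def by simp
  from sum_pmf_eq_1[OF _ this] show ?thesis unfolding sum_lessThan_add_2 by simp
qed

lemma successor_inst_config:
  "d \<in> configs (mdp_of (inst x)) \<Longrightarrow> a \<le> length As \<Longrightarrow>
    successor (mdp_of (inst x)) d a \<in> configs (mdp_of (inst x))"
  by (rule successor_in_configs[OF valid_instance_mdp(1)[OF valid_machine_instance]])
    (simp_all add: mdp_inst(2))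

text \<open>The accepting and the rejecting state are absorbing, so letters after the final action
  cannot change the verdict.\<close>

lemma exhausted_constant:
  assumes "d \<in> configs (mdp_of (inst x))" "\<forall>q<5 * N. pmf d q = 0" "set v \<subseteq> {..length As}"
  shows "pmf (foldl (successor (mdp_of (inst x))) d v) (5 * N) = pmf d (5 * N)"
  using assms
proof (induction v arbitrary: d)
  case (Cons a v)
  let ?d = "successor (mdp_of (inst x)) d a"
  have a: "a \<le> length As" using Cons.prems by simp
  have "pmf ?d q = 0" if "q < 5 * N" for q
    using pmf_successor_transient[OF Cons.prems(1) a that] Cons.prems(2) that by simp
  moreover have "pmf ?d (5 * N) = pmf d (5 * N)"
    using pmf_successor_inst[OF Cons.prems(1) a, of "5 * N"] Cons.prems(2) by simp
  ultimately show ?case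
    using Cons.IH[of ?d] Cons.prems successor_inst_config[OF Cons.prems(1) a] by simp
qed simp

lemma final_action_exhausts:
  assumes "d \<in> configs (mdp_of (inst x))"
  shows "\<forall>q<5 * N. pmf (successor (mdp_of (inst x)) d (length As)) q = 0"
  using pmf_successor_transient[OF assms order_refl] by (simp add: stay_def)

text \<open>The balance can only fall along \<open>v\<close>, and the target requires it to be
  nonnegative in the end. Hence no penalty was ever paid and all tests were correct. The hypothesis
  is an inequality because in the induction earlier penalties are not yet known to vanish.\<close>

lemma reach_imp_accepts:
  assumes "d \<in> configs (mdp_of (inst x))" "represents d m c" "0 < m" "balance d \<le> 0"
    and "set v \<subseteq> {..length As}" "1 / 2 \<le> pmf (foldl (successor (mdp_of (inst x))) d v) (5 * N)"
  shows "balance d = 0 \<and> (\<exists>w. set w \<subseteq> set As \<and> accepts h c w)"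
  using assms
proof (induction v arbitrary: d m c)
  case Nil
  \<comment> \<open>State 0 still carries the mass \<open>m\<close> of counter 0. With a nonpositive
    balance less than half of the mass is then accepted, so the target cannot be met before the
    final action.\<close>
  have "0 < pmf d 0" using Nil.prems(2,3) h unfolding represents_def
    by (metis mult_0_right neq0_conv not_less_zero)
  also have "\<dots> \<le> (\<Sum>q<5 * N. pmf d q)"
    using h by (intro member_le_sum) auto
  finally show ?case
    using sum_config[OF Nil.prems(1)] Nil.prems(4,6) by (simp add: balance_def)
next
  case (Cons a v)
  let ?d = "successor (mdp_of (inst x)) d a"
  have a: "a \<le> length As" using Cons.prems by simp
  note d' = successor_inst_config[OF Cons.prems(1) a]
  have fin: "finite (tested As h a)" using tested_subset finite_subset by blast
  have bal: "balance ?d = balance d - penalty m c (tested As h a)"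
    by (rule balance_successor[OF Cons.prems(1) a Cons.prems(2)])
  have pen: "0 \<le> penalty m c (tested As h a)" using Cons.prems(3) by (simp add: penalty_nonneg)
  show ?case
  proof (cases "a < length As")
    case True
    have "balance ?d = 0 \<and> (\<exists>w. set w \<subseteq> set As \<and> accepts h (\<lambda>j. c j + snd (As ! a) j) w)"
      using Cons.prems bal pen
      by (intro Cons.IH[OF d' represents_successor[OF Cons.prems(1) a Cons.prems(2) True]]) auto
    then obtain w where w: "balance ?d = 0" "set w \<subseteq> set As" "accepts h (\<lambda>j. c j + snd (As ! a) j) w" by blast
    then have "balance d = 0" "penalty m c (tested As h a) = 0" using bal pen Cons.prems(4) by auto
    moreover from this have "\<forall>j\<in>fst (As ! a). c j = 0"
      using penalty_eq_0_iff[OF Cons.prems(3) fin] True by (simp add: tested_def)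
    ultimately have "balance d = 0" "set (As ! a # w) \<subseteq> set As" "accepts h c (As ! a # w)"
      using w True by auto
    then show ?thesis by blast
  next
    case False
    then have [simp]: "a = length As" using a by simp
    have zero: "\<forall>q<5 * N. pmf ?d q = 0" using final_action_exhausts[OF Cons.prems(1)] by simp
    have "1 / 2 \<le> pmf ?d (5 * N)"
      using exhausted_constant[OF d' zero, of v] Cons.prems(5,6) by simp
    moreover have "pmf ?d (5 * N) + pmf ?d (5 * N + 1) = 1"
      using sum_config[OF d'] zero by simp
    ultimately have "0 \<le> balance ?d" by (simp add: balance_def)
    then have "balance d = 0" "penalty m c (tested As h a) = 0" using bal pen Cons.prems(4) by auto
    moreover from this have "c h = 0"
      using penalty_eq_0_iff[OF Cons.prems(3) fin] by (simp add: tested_def)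
    ultimately show ?thesis by (intro conjI exI[of _ "[]"]) auto
  qed
qed

lemma accepts_imp_reach:
  assumes "d \<in> configs (mdp_of (inst x))" "represents d m c" "0 < m" "balance d = 0"
    and "set w \<subseteq> set As" "accepts h c w"
  shows "\<exists>v. set v \<subseteq> {..length As} \<and> 1 / 2 \<le> pmf (foldl (successor (mdp_of (inst x))) d v) (5 * N)"
  using assms
proof (induction w arbitrary: d m c)
  case Nil
  let ?d = "successor (mdp_of (inst x)) d (length As)"
  have "penalty m c (tested As h (length As)) = 0"
    using Nil.prems(6) by (simp add: penalty_def tested_def half_pow_def)
  then have "balance ?d = 0"
    using balance_successor[OF Nil.prems(1) order_refl Nil.prems(2)] Nil.prems(4) by simp
  moreover have "pmf ?d (5 * N) + pmf ?d (5 * N + 1) = 1"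
    using sum_config[OF successor_inst_config[OF Nil.prems(1) order_refl]] final_action_exhausts[OF Nil.prems(1)]
    by simp
  ultimately have "1 / 2 \<le> pmf ?d (5 * N)" by (simp add: balance_def)
  then show ?case by (intro exI[of _ "[length As]"]) simp
next
  case (Cons b w)
  have "b \<in> set As" using Cons.prems(5) by simp
  then obtain a where a: "a < length As" "b = As ! a" by (metis in_set_conv_nth)
  then have a': "a \<le> length As" by simp
  let ?d = "successor (mdp_of (inst x)) d a"
  have "penalty m c (tested As h a) = 0"
    using Cons.prems(6) a by (simp add: penalty_def tested_def half_pow_def)
  then have "balance ?d = 0"
    using balance_successor[OF Cons.prems(1) a' Cons.prems(2)] Cons.prems(4) by simp
  moreover have "0 < m / 8" "set w \<subseteq> set As" "accepts h (\<lambda>j. c j + snd (As ! a) j) w"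
    using Cons.prems a by simp_all
  ultimately have "\<exists>v. set v \<subseteq> {..length As} \<and> 1 / 2 \<le> pmf (foldl (successor (mdp_of (inst x))) ?d v) (5 * N)"
    by (intro Cons.IH[OF successor_inst_config[OF Cons.prems(1) a']
          represents_successor[OF Cons.prems(1) a' Cons.prems(2) a(1)]])
  then obtain v where v: "set v \<subseteq> {..length As}"
    "1 / 2 \<le> pmf (foldl (successor (mdp_of (inst x))) ?d v) (5 * N)" by blast
  show ?case by (rule exI[of _ "a # v"]) (use v a' in simp)
qed

lemma init_config: "init_of (inst x) \<in> configs (mdp_of (inst x))"
  by (rule valid_instance_mdp(2)[OF valid_machine_instance])

lemma represents_init: "represents (init_of (inst x)) (1 / (3 * real N)) (\<lambda>j. int (x j))"
  unfolding represents_def using pmf_init_inst[of _ x] by simp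

lemma balance_init: "balance (init_of (inst x)) = 0"
  unfolding balance_def init_balanced by simp

theorem word_reach_iff_accepts:
  "(\<exists>v. set v \<subseteq> actions (mdp_of (inst x)) \<and>
      config_vec (states (mdp_of (inst x))) (foldl (successor (mdp_of (inst x))) (init_of (inst x)) v) \<in> target_of (inst x)) \<longleftrightarrow>
    (\<exists>w. set w \<subseteq> set As \<and> accepts h (\<lambda>j. int (x j)) w)"
  (is "?L \<longleftrightarrow> ?R")
proof
  have pos: "0 < 1 / (3 * real N)" using h by simp
  {
    assume ?L
    then obtain v where v: "set v \<subseteq> {..length As}"
      "1 / 2 \<le> pmf (foldl (successor (mdp_of (inst x))) (init_of (inst x)) v) (5 * N)"
      unfolding target_inst mdp_inst(2) by (elim exE conjE)
    from reach_imp_accepts[OF init_config represents_init pos eq_refl[OF balance_init] v]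
    show ?R by (rule conjunct2)
  next
    assume ?R
    then obtain w where w: "set w \<subseteq> set As" "accepts h (\<lambda>j. int (x j)) w" by (elim exE conjE)
    show ?L unfolding target_inst mdp_inst(2)
      by (rule accepts_imp_reach[OF init_config represents_init pos balance_init w])
  }
qed

end

section \<open>Computability of the reduction\<close>

definition computable :: "nat \<Rightarrow> (nat list \<Rightarrow> nat) \<Rightarrow> bool" where
  "computable k F \<longleftrightarrow> (\<exists>f. \<forall>xs. length xs = k \<longrightarrow> rec_eval f xs (F xs))"

lemma computable_cong: "(\<And>xs. length xs = k \<Longrightarrow> F xs = G xs) \<Longrightarrow> computable k F \<Longrightarrow> computable k G"
  unfolding computable_def by metis

lemma computable_nth: "i < k \<Longrightarrow> computable k (\<lambda>xs. xs ! i)"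
  unfolding computable_def by (metis rec_eval.Proj)

lemma computable_comp:
  assumes "computable (length Gs) F" "\<forall>G\<in>set Gs. computable k G"
  shows "computable k (\<lambda>xs. F (map (\<lambda>G. G xs) Gs))"
proof -
  obtain f where f: "\<And>xs. length xs = length Gs \<Longrightarrow> rec_eval f xs (F xs)"
    using assms(1) by (auto simp: computable_def)
  from assms(2) have "\<exists>gs. \<forall>xs. length xs = k \<longrightarrow> list_all2 (\<lambda>g y. rec_eval g xs y) gs (map (\<lambda>G. G xs) Gs)"
  proof (induction Gs)
    case Nil
    then show ?case by auto
  next
    case (Cons G Gs)
    then obtain gs g where "\<forall>xs. length xs = k \<longrightarrow> list_all2 (\<lambda>g y. rec_eval g xs y) gs (map (\<lambda>G. G xs) Gs)"
      "\<forall>xs. length xs = k \<longrightarrow> rec_eval g xs (G xs)"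
      by (auto simp: computable_def)
    then show ?case by (intro exI[of _ "g # gs"]) simp
  qed
  then obtain gs where gs:
    "\<And>xs. length xs = k \<Longrightarrow> list_all2 (\<lambda>g y. rec_eval g xs y) gs (map (\<lambda>G. G xs) Gs)" by blast
  then have "rec_eval (Comp f gs) xs (F (map (\<lambda>G. G xs) Gs))" if "length xs = k" for xs
    using rec_eval.Comp[OF gs[OF that] f] by simp
  then show ?thesis unfolding computable_def by blast
qed

lemma computable_unary:
  assumes "computable 1 (\<lambda>xs. u (xs ! 0))" "computable k F"
  shows "computable k (\<lambda>xs. u (F xs))"
  using computable_comp[of "[F]" "\<lambda>xs. u (xs ! 0)" k] assms by simp

lemma computable_binary:
  assumes "computable 2 (\<lambda>xs. u (xs ! 0) (xs ! 1))" "computable k F" "computable k G"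
  shows "computable k (\<lambda>xs. u (F xs) (G xs))"
  using computable_comp[of "[F, G]" "\<lambda>xs. u (xs ! 0) (xs ! 1)" k] assms by (simp add: numeral_2_eq_2)

lemma computable_Suc:
  assumes "computable k F"
  shows "computable k (\<lambda>xs. Suc (F xs))"
proof (rule computable_unary[OF _ assms])
  have "rec_eval Succ xs (Suc (xs ! 0))" if "length xs = 1" for xs
    using that by (auto simp: length_Suc_conv intro: rec_eval.Succ)
  then show "computable 1 (\<lambda>xs. Suc (xs ! 0))" unfolding computable_def by blast
qed

lemma computable_const: "computable k (\<lambda>xs. c)"
proof (induction c)
  case 0
  show ?case unfolding computable_def using rec_eval.Zero by blast
qed (rule computable_Suc)

lemma computable_rec:
  assumes "computable k F" "computable (Suc (Suc k)) G"
  shows "computable (Suc k) (\<lambda>xs. rec_nat (F (tl xs)) (\<lambda>n r. G (n # r # tl xs)) (hd xs))"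
proof -
  obtain f g where f: "\<And>xs. length xs = k \<Longrightarrow> rec_eval f xs (F xs)"
    and g: "\<And>xs. length xs = Suc (Suc k) \<Longrightarrow> rec_eval g xs (G xs)"
    using assms unfolding computable_def by blast
  have "rec_eval (PrimRec f g) (n # xs) (rec_nat (F xs) (\<lambda>n r. G (n # r # xs)) n)" if "length xs = k" for n xs
    using that f g by (induction n) (auto intro: rec_eval.PrimRec_0 rec_eval.PrimRec_Suc)
  then have "rec_eval (PrimRec f g) xs (rec_nat (F (tl xs)) (\<lambda>n r. G (n # r # tl xs)) (hd xs))"
    if "length xs = Suc k" for xs
    using that by (cases xs) auto
  then show ?thesis unfolding computable_def by blast
qed

lemma computable_add:
  assumes "computable k F" "computable k G"
  shows "computable k (\<lambda>xs. F xs + G xs)"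
proof (rule computable_binary[OF _ assms])
  have "computable (Suc 1) (\<lambda>xs. rec_nat (tl xs ! 0) (\<lambda>n r. Suc ((n # r # tl xs) ! 1)) (hd xs))"
    by (rule computable_rec[where F = "\<lambda>xs. xs ! 0" and G = "\<lambda>xs. Suc (xs ! 1)"];
        intro computable_Suc computable_nth; simp)
  moreover have "rec_nat y (\<lambda>n r. Suc r) x = x + y" for x y :: nat by (induction x) auto
  ultimately show "computable 2 (\<lambda>xs. xs ! 0 + xs ! 1)"
    unfolding Suc_1 by (elim computable_cong[rotated]) (auto simp: length_Suc_conv numeral_2_eq_2)
qed

lemma computable_mult:
  assumes "computable k F" "computable k G"
  shows "computable k (\<lambda>xs. F xs * G xs)"
proof (rule computable_binary[OF _ assms])
  have "computable (Suc 1) (\<lambda>xs. rec_nat 0 (\<lambda>n r. (n # r # tl xs) ! 1 + (n # r # tl xs) ! 2) (hd xs))"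
    by (rule computable_rec[where F = "\<lambda>_. 0" and G = "\<lambda>xs. xs ! 1 + xs ! 2"];
        intro computable_const computable_add computable_nth; simp)
  moreover have "rec_nat 0 (\<lambda>n r. r + y) x = x * y" for x y :: nat by (induction x) auto
  ultimately show "computable 2 (\<lambda>xs. xs ! 0 * xs ! 1)"
    unfolding Suc_1 by (elim computable_cong[rotated]) (auto simp: length_Suc_conv numeral_2_eq_2)
qed

lemma computable_rec_unary:
  assumes "computable 2 (\<lambda>xs. G (xs ! 0) (xs ! 1))" "computable k F"
  shows "computable k (\<lambda>xs. rec_nat c G (F xs))"
proof (rule computable_unary[OF _ assms(2)])
  have "computable (Suc 0) (\<lambda>xs. rec_nat c (\<lambda>n r. G ((n # r # tl xs) ! 0) ((n # r # tl xs) ! 1)) (hd xs))"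
    using assms(1) by (intro computable_rec[where F = "\<lambda>_. c" and G = "\<lambda>xs. G (xs ! 0) (xs ! 1)"] computable_const)
      (simp add: numeral_2_eq_2)
  then show "computable 1 (\<lambda>xs. rec_nat c G (xs ! 0))"
    unfolding One_nat_def[symmetric]
    by (elim computable_cong[rotated]) (auto simp: length_Suc_conv hd_conv_nth)
qed

lemma computable_pred:
  assumes "computable k F"
  shows "computable k (\<lambda>xs. F xs - 1)"
proof -
  have "computable k (\<lambda>xs. rec_nat 0 (\<lambda>n r. n) (F xs))"
    by (rule computable_rec_unary[OF _ assms]; rule computable_nth; simp)
  moreover have "rec_nat 0 (\<lambda>n r. n) x = x - 1" for x by (cases x) auto
  ultimately show ?thesis by simp
qed

lemma computable_power:
  assumes "computable k F"
  shows "computable k (\<lambda>xs. b ^ F xs)"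
proof -
  have "computable k (\<lambda>xs. rec_nat 1 (\<lambda>n r. b * r) (F xs))"
    by (rule computable_rec_unary[OF _ assms]; intro computable_mult computable_const computable_nth; simp)
  moreover have "rec_nat 1 (\<lambda>n r. b * r) x = b ^ x" for x by (induction x) auto
  ultimately show ?thesis by simp
qed

lemma computable_prod_encode:
  assumes "computable k F" "computable k G"
  shows "computable k (\<lambda>xs. prod_encode (F xs, G xs))"
proof -
  have "computable k (\<lambda>xs. rec_nat 0 (\<lambda>n r. r + Suc n) (F xs + G xs) + F xs)"
    by (intro computable_add computable_rec_unary assms computable_Suc computable_nth; simp)
  moreover have "rec_nat 0 (\<lambda>n r. r + Suc n) x = triangle x" for x by (induction x) auto
  ultimately show ?thesis by (simp add: prod_encode_def)
qed

lemmas computable_intros = computable_const computable_nth computable_power computable_pred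
  computable_prod_encode computable_Suc computable_add computable_mult

section \<open>Codes of the diagonal instances\<close>

definition Cons_code :: "nat \<Rightarrow> nat \<Rightarrow> nat" where
  "Cons_code x r = Suc (prod_encode (x, r))"

lemma list_encode_Cons: "list_encode (x # xs) = Cons_code x (list_encode xs)"
  by (simp add: Cons_code_def)

lemma computable_Cons_code:
  "computable k F \<Longrightarrow> computable k G \<Longrightarrow> computable k (\<lambda>xs. Cons_code (F xs) (G xs))"
  unfolding Cons_code_def by (intro computable_intros)

text \<open>A list code is an iterated pairing, so the five entries of one counter can be prepended
  to the code \<open>r\<close> of the remaining table by arithmetic alone.\<close>

definition counter_code :: "nat \<Rightarrow> nat \<Rightarrow> nat \<Rightarrow> nat" where
  "counter_code N n r =
    Cons_code (prod_encode (1, 3 * N)) (Cons_code (prod_encode (1, 3 * N * 2 ^ n))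
    (Cons_code (prod_encode (2 ^ n - 1, 3 * N * 2 ^ n)) (Cons_code (prod_encode (1, 3 * N * 4 ^ n))
    (Cons_code (prod_encode (4 ^ n - 1, 3 * N * 4 ^ n)) r))))"

lemma computable_counter_code:
  "computable k F \<Longrightarrow> computable k G \<Longrightarrow> computable k H \<Longrightarrow>
    computable k (\<lambda>xs. counter_code (F xs) (G xs) (H xs))"
  unfolding counter_code_def by (intro computable_Cons_code computable_intros)

lemma vec_encode_init_frac:
  assumes "j < N"
  shows "vec_encode (map (init_frac N x) [5 * j..<5 * N + 2]) =
    counter_code N (x j) (vec_encode (map (init_frac N x) [5 * Suc j..<5 * N + 2]))"
proof -
  have lt: "5 * j < 5 * N" "5 * j + 1 < 5 * N" "5 * j + 2 < 5 * N" "5 * j + 3 < 5 * N" "5 * j + 4 < 5 * N"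
    using assms by auto
  have "[5 * j..<5 * N + 2] =
      [5 * j, 5 * j + 1, 5 * j + 2, 5 * j + 3, 5 * j + 4] @ [5 * Suc j..<5 * N + 2]"
  proof -
    have "[5 * j..<5 * N + 2] = [5 * j..<5 * j + 5] @ [5 * j + 5..<5 * N + 2]"
      using assms upt_add_eq_append[of "5 * j" "5 * j + 5" "5 * N + 2 - (5 * j + 5)"] by simp
    moreover have "[n..<n + 5] = [n, n + 1, n + 2, n + 3, n + 4]" for n
      by (simp add: upt_rec numeral_eq_Suc)
    moreover have "5 * Suc j = 5 * j + 5" by simp
    ultimately show ?thesis by (simp only: append_Cons append_Nil)
  qed
  moreover have "frac_encode (init_frac N x (5 * j)) = prod_encode (1, 3 * N)"
    "frac_encode (init_frac N x (5 * j + 1)) = prod_encode (1, 3 * N * 2 ^ x j)"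
    "frac_encode (init_frac N x (5 * j + 2)) = prod_encode (2 ^ x j - 1, 3 * N * 2 ^ x j)"
    "frac_encode (init_frac N x (5 * j + 3)) = prod_encode (1, 3 * N * 4 ^ x j)"
    "frac_encode (init_frac N x (5 * j + 4)) = prod_encode (4 ^ x j - 1, 3 * N * 4 ^ x j)"
    using lt unfolding init_frac_def block_div_mod frac_encode_def by simp_all
  ultimately show ?thesis
    by (simp only: vec_encode_def list.map append.simps list_encode_Cons counter_code_def)
qed

text \<open>
  The list \<open>p\<close> describes a machine with five input counters by the number of counters, the number
  of actions and the codes of the transition table, of the part of the initial table that does
  not depend on the input, and of the generators. In the diagonal instance, \<open>p\<close> is also the input.
\<close>

definition diagonal_code :: "nat list \<Rightarrow> nat" where
  "diagonal_code p =
    Cons_code (5 * p ! 0 + 2) (Cons_code (p ! 1) (Cons_code (p ! 2) (Cons_code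
      (counter_code (p ! 0) (p ! 0) (counter_code (p ! 0) (p ! 1) (counter_code (p ! 0) (p ! 2)
        (counter_code (p ! 0) (p ! 3) (counter_code (p ! 0) (p ! 4) (p ! 3))))))
      (Cons_code 1 (Cons_code (p ! 4) (Cons_code (prod_encode (1, 1)) 0))))))"

lemma computable_diagonal_code: "computable 5 diagonal_code"
  unfolding diagonal_code_def
  by (intro computable_Cons_code computable_counter_code computable_intros; simp)

definition diagonal_input :: "nat list \<Rightarrow> (nat \<Rightarrow> nat) \<Rightarrow> nat \<Rightarrow> nat" where
  "diagonal_input p init j = (if j < 5 then p ! j else init j)"

lemma instance_encode_diagonal:
  assumes "5 \<le> N"
  obtains p where "length p = 5"
    "instance_encode (machine_instance N As h (diagonal_input p init)) = diagonal_code p"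
proof -
  let ?I = "machine_instance N As h"
  \<comment> \<open>The components are taken from the machine run on \<open>init\<close>. They are
    the same for every input, so \<open>p\<close> is defined without reference to the instance in
    which it becomes the input. The index 25 skips the five states of each of the five input
    counters.\<close>
  define p where "p = [N, Suc (length As),
    list_encode (map (\<lambda>row. list_encode (map vec_encode row)) (trans_table (?I init))),
    vec_encode (map (init_frac N init) [25..<5 * N + 2]),
    list_encode (map vec_encode (generators (?I init)))]"
  let ?x = "diagonal_input p init"
  have tail: "map (init_frac N ?x) [25..<5 * N + 2] = map (init_frac N init) [25..<5 * N + 2]"
    by (auto simp: init_frac_def diagonal_input_def)
  define M where "M = 5 * N + 2"
  have step: "vec_encode (map (init_frac N ?x) [5 * j..<M]) =
      counter_code N (p ! j) (vec_encode (map (init_frac N ?x) [5 * Suc j..<M]))" if "j < 5" for j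
    using vec_encode_init_frac[of j N ?x] assms that by (simp add: M_def diagonal_input_def del: upt_Suc)
  have "vec_encode (map (init_frac N ?x) [25..<M]) = p ! 3"
    unfolding M_def tail by (simp add: p_def del: upt_Suc)
  then have "vec_encode (map (init_frac N ?x) [0..<M]) =
      counter_code N (p ! 0) (counter_code N (p ! 1) (counter_code N (p ! 2)
        (counter_code N (p ! 3) (counter_code N (p ! 4) (p ! 3)))))"
    using step[of 0] step[of 1] step[of 2] step[of 3] step[of 4] by simp
  then have "instance_encode (?I ?x) = diagonal_code p"
    unfolding M_def
    by (simp add: instance_encode_def machine_instance_def diagonal_code_def list_encode_Cons
        frac_encode_def p_def del: upt_Suc list_encode.simps(2))
  then show ?thesis by (intro that[of p]) (simp_all add: p_def)
qed

section \<open>Diagonalisation against a decision procedure\<close>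

theorem theorem25:
  shows "\<not> decidable_problem instance_encode {I. valid_instance I}
    (\<lambda>I. \<exists>\<sigma>. scheduler (mdp_of I) \<sigma> \<and>
      measure (path_measure (mdp_of I) \<sigma> (init_of I)) (Reach (mdp_of I) (init_of I) (target_of I))
        \<ge> frac_val (threshold I))"
proof
  let ?P = "\<lambda>I. \<exists>\<sigma>. scheduler (mdp_of I) \<sigma> \<and>
      measure (path_measure (mdp_of I) \<sigma> (init_of I)) (Reach (mdp_of I) (init_of I) (target_of I))
        \<ge> frac_val (threshold I)"
  assume "decidable_problem instance_encode {I. valid_instance I} ?P"
  then obtain f where f: "rec_eval f [instance_encode I] (if ?P I then 1 else 0)" if "valid_instance I" for I
    unfolding decidable_problem_def by blast
  obtain c where c: "rec_eval c p (diagonal_code p)" if "length p = 5" for p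
    using computable_diagonal_code unfolding computable_def by blast
  \<comment> \<open>The projections start at 1 and thus skip the search variable. The search
    succeeds at 0 if \<open>f\<close> answers 0 on the instance coded by
    \<open>diagonal_code p\<close>, and is undefined if \<open>f\<close> answers 1; so
    \<open>g\<close> is defined exactly where the decision is negative.\<close>
  define g where "g = Mu (Comp f [Comp c (map Proj [1..<6])])"
  from rec_eval_program[of g 5] obtain prog where prog:
    "\<And>\<sigma>. (\<exists>s. (ints \<sigma>, s) \<in> sem prog) \<longleftrightarrow> (\<exists>y. rec_eval g (map \<sigma> [0..<5]) y)" by blast
  from program_counter_machine[of 5 prog] obtain N As h init where machine:
    "5 \<le> N" "h < N" "\<forall>(Z, u)\<in>set As. Z \<subseteq> {..<N} \<and> (\<forall>j. u j \<in> {-1, 0, 1})"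
    "\<And>x. (\<exists>w. set w \<subseteq> set As \<and> accepts h (ints (\<lambda>j. if j < 5 then x j else init j)) w) \<longleftrightarrow>
      (\<exists>s. (ints (\<lambda>j. if j < 5 then x j else 0), s) \<in> sem prog)"
    by blast
  interpret counter_machine N As h using machine by unfold_locales auto
  from instance_encode_diagonal[OF machine(1), of As h init] obtain p where p: "length p = 5"
    "instance_encode (inst (diagonal_input p init)) = diagonal_code p" by blast
  define I where "I = inst (diagonal_input p init)"
  have "frac_val (threshold I) = 1" by (simp add: I_def machine_instance_def frac_val_def)
  then have "?P I \<longleftrightarrow> (\<exists>v. set v \<subseteq> actions (mdp_of I) \<and>
      config_vec (states (mdp_of I)) (foldl (successor (mdp_of I)) (init_of I) v) \<in> target_of I)"
    using almost_sure_reach_iff_word[of "mdp_of I" "init_of I" "target_of I"]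
      valid_instance_mdp[OF valid_machine_instance[of "diagonal_input p init"]]
    by (simp add: mdp_inst I_def)
  also have "\<dots> \<longleftrightarrow> (\<exists>w. set w \<subseteq> set As \<and> accepts h (ints (diagonal_input p init)) w)"
    unfolding I_def by (rule word_reach_iff_accepts)
  also have "\<dots> \<longleftrightarrow> (\<exists>s. (ints (\<lambda>j. if j < 5 then p ! j else 0), s) \<in> sem prog)"
    unfolding diagonal_input_def by (rule machine(4))
  also have "\<dots> \<longleftrightarrow> (\<exists>y. rec_eval g (map (\<lambda>j. if j < 5 then p ! j else 0) [0..<5]) y)"
    by (rule prog)
  also have "map (\<lambda>j. if j < 5 then p ! j else 0) [0..<5] = p"
    using p(1) by (intro nth_equalityI) auto
  finally have P: "?P I \<longleftrightarrow> (\<exists>y. rec_eval g p y)" .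
  have eval: "rec_eval (Comp f [Comp c (map Proj [1..<6])]) (i # p) (if ?P I then 1 else 0)" for i
  proof -
    have "list_all2 (\<lambda>g y. rec_eval g (i # p) y) (map Proj [1..<6]) p"
      unfolding list_all2_conv_all_nth
    proof (intro conjI allI impI)
      show "length (map Proj [1..<6]) = length p" using p(1) by simp
      fix j assume "j < length (map Proj [1..<6])"
      then have j: "j < 5" by simp
      have "rec_eval (Proj (Suc j)) (i # p) ((i # p) ! Suc j)"
        using j p(1) by (intro rec_eval.Proj) simp
      then show "rec_eval (map Proj [1..<6] ! j) (i # p) (p ! j)" using j by simp
    qed
    from rec_eval.Comp[OF this c[OF p(1)]]
    have "list_all2 (\<lambda>g y. rec_eval g (i # p) y) [Comp c (map Proj [1..<6])] [instance_encode I]"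
      by (simp add: I_def p(2))
    moreover have "valid_instance I" unfolding I_def by (rule valid_machine_instance)
    ultimately show ?thesis using f by (intro rec_eval.Comp)
  qed
  show False
  proof (cases "?P I")
    case True
    then obtain y where "rec_eval g p y" using P by blast
    then have "rec_eval (Comp f [Comp c (map Proj [1..<6])]) (y # p) 0"
      unfolding g_def by (cases rule: rec_eval.cases) auto
    from rec_eval_deterministic[OF this eval[of y]] show False using True by simp
  next
    case False
    have "rec_eval (Comp f [Comp c (map Proj [1..<6])]) (0 # p) 0"
      using eval[of 0] unfolding if_not_P[OF False] .
    then have "rec_eval g p 0" unfolding g_def by (rule rec_eval.Mu) simp
    then show False using P False by blast
  qed
qed

end
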